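(* Let $o\in\mathbb{H}^{p,q-1}$, $\tau\in S^o$, and let $\mathfrak{b}^+$ be a closed Weyl chamber of a maximal subalgebra $\mathfrak{b}\subset\mathfrak{p}^\tau\cap\mathfrak{q}^o$, with associated projection $b^o:\mathscr{C}^>_{o,G}\to\mathfrak{b}^+$. For every $g\in\mathscr{C}^>_{o,G}$ one has $$\ell_{o,g\cdot o}=|b^o(g)|^{1/2}=d_{X_G}(S^o,g\cdot S^o).$$
   Context: Fix integers $p,q\ge1$ with $d:=p+q>2$. On $\mathbb{R}^d$ let $\langle x,y\rangle_{p,q}:=\sum_{i=1}^p x_iy_i-\sum_{i=p+1}^d x_iy_i$, with orthogonal complements denoted $\cdot^{\perp_{p,q}}$. $G:=\mathrm{PSO}(p,q)\subset\mathrm{PSL}(d,\mathbb{R})$ is the group of projectivized matrices of $\mathrm{SL}(d,\mathbb{R})$ preserving the form, with Lie algebra $\mathfrak{g}=\mathfrak{so}(p,q)$ and Killing form $\kappa(X,Y)=(d-2)\mathrm{tr}(XY)$. $\mathbb{H}^{p,q-1}:=\{o=[\hat o]\in\mathbb{P}(\mathbb{R}^d):\langle\hat o,\hat o\rangle_{p,q}<0\}$ carries the pseudo-Riemannian metric induced from the restriction of the form to the tangent spaces of $\{\hat o:\langle\hat o,\hat o\rangle_{p,q}=-1\}$. Its space-like geodesics are the intersections with $\mathbb{H}^{p,q-1}$ of projectivized $2$-planes on which the form has signature $(1,1)$. For $o\in\mathbb{H}^{p,q-1}$, $\mathscr{C}^>_o$ is the set of points of $\mathbb{H}^{p,q-1}$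 that can be joined to $o$ by a space-like geodesic; for $o'\in\mathscr{C}^>_o$, $\ell_{o,o'}$ is the length of the geodesic segment connecting $o$ and $o'$ (e.g. $s\mapsto[\sinh s,0,\dots,0,\cosh s]$ is parametrized by arc-length). $\mathscr{C}^>_{o,G}:=\{g\in G:g\cdot o\in\mathscr{C}^>_o\}$. Let $J^o:=\mathrm{id}_o\oplus(-\mathrm{id}_{o^{\perp_{p,q}}})$, $H^o$ the stabilizer of $o$ in $G$, $\mathfrak{q}^o:=\{X\in\mathfrak{g}:J^oXJ^o=-X\}$, and for $X\in\mathfrak{q}^o$ put $|X|:=\frac{1}{2(d-2)}\kappa(X,X)$. $X_G$ is the space of $q$-dimensional negative definite subspaces $\tau$ of $\mathbb{R}^d$; $S^o:=\{\tau\in X_G:o\subset\tau\}$. For $\tau\in X_G$, $\langle\cdot,\cdot\rangle_\tau$ is the inner product equal to $-\langle\cdot,\cdot\rangle_{p,q}$ on $\tau$, to $\langle\cdot,\cdot\rangle_{p,q}$ on $\tau^{\perp_{p,q}}$ and making these orthogonal; $\mathfrak{p}^\tau$ is the set of $X\in\mathfrak{g}$ symmetric for $\langle\cdot,\cdot\rangle_\tau$, identified with $T_\tau X_G$. $d_{X_G}$ is the distance of the $G$-invariant Riemannian metric with $d_{X_G}(\tau,\exp(X)\cdot\tau)=(\frac{1}{2(d-2)}\kappa(X,X))^{1/2}$ for $X\in\mathfrak{p}^\tau$; $d_{X_G}(A,B):=\inf\{d_{X_G}(a,b):a\in A,b\in B\}$. For $\tau\in S^o$, a maximal subalgebra $\mathfrak{b}\subset\mathfrak{p}^\tau\cap\mathfrak{q}^o$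 is abelian and one-dimensional; a closed Weyl chamber $\mathfrak{b}^+$ is a closed half-line of $\mathfrak{b}$ starting at $0$. Every $g\in\mathscr{C}^>_{o,G}$ can be written $g=h\exp(X)h'$ with $h,h'\in H^o$ and a unique $X\in\mathfrak{b}^+$; set $b^o(g):=X$. *)

theory Defs
  imports "HOL-Analysis.Analysis"
begin

text \<open>
  The integers p, q \<open>\<ge>\<close> 1 are the cardinalities of two finite index types, so
  \<open>real ^ ('p + 'q)\<close> is the space of dimension d = p + q; the \<open>Inl\<close> coordinates carry the sign
  plus and the \<open>Inr\<close> coordinates the sign minus.
\<close>

type_synonym ('p, 'q) vpq = "real ^ ('p + 'q)"
type_synonym ('p, 'q) mpq = "real ^ ('p + 'q) ^ ('p + 'q)"

definition form :: "('p::finite, 'q::finite) vpq \<Rightarrow> ('p, 'q) vpq \<Rightarrow> real" where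
  "form x y = (\<Sum>i\<in>UNIV. x $ Inl i * y $ Inl i) - (\<Sum>j\<in>UNIV. x $ Inr j * y $ Inr j)"

definition perp :: "('p::finite, 'q::finite) vpq set \<Rightarrow> ('p, 'q) vpq set" where
  "perp W = {y. \<forall>x\<in>W. form x y = 0}"

text \<open>The projection onto \<open>W\<close> along \<open>perp W\<close>; meaningful when the form is nondegenerate on \<open>W\<close>.\<close>

definition proj :: "('p::finite, 'q::finite) vpq set \<Rightarrow> ('p, 'q) mpq" where
  "proj W = (THE P. (\<forall>x\<in>W. P *v x = x) \<and> (\<forall>y\<in>perp W. P *v y = 0))"


subsection \<open>The group PSO(p,q) and its Lie algebra\<close>

text \<open>
  An element of PSL(d,R) is represented as a coset of the scalar matrices in SL(d,R), that is, as
  the set of all its representatives of determinant 1.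
\<close>

definition psl_class :: "real ^ 'n ^ 'n \<Rightarrow> (real ^ 'n ^ 'n) set" where
  "psl_class A = {B. det B = 1 \<and> (\<exists>c. B = c *\<^sub>R A)}"

definition psl_mult :: "(real ^ 'n ^ 'n) set \<Rightarrow> (real ^ 'n ^ 'n) set \<Rightarrow> (real ^ 'n ^ 'n) set" where
  "psl_mult g h = {A ** B | A B. A \<in> g \<and> B \<in> h}"

text \<open>Action on linear subspaces: all representatives of \<open>g\<close> have the same image of \<open>W\<close>.\<close>

definition psl_act :: "(real ^ 'n ^ 'n) set \<Rightarrow> (real ^ 'n) set \<Rightarrow> (real ^ 'n) set" where
  "psl_act g W = (\<Union>A\<in>g. (*v) A ` W)"

definition SO_pq :: "('p::finite, 'q::finite) mpq set" where
  "SO_pq = {A. det A = 1 \<and> (\<forall>x y. form (A *v x) (A *v y) = form x y)}"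

definition PSO_pq :: "('p::finite, 'q::finite) mpq set set" where
  "PSO_pq = psl_class ` SO_pq"

definition so_pq :: "('p::finite, 'q::finite) mpq set" where
  "so_pq = {X. \<forall>x y. form (X *v x) y + form x (X *v y) = 0}"

text \<open>Killing form of so(p,q).\<close>

definition killing :: "('p::finite, 'q::finite) mpq \<Rightarrow> ('p, 'q) mpq \<Rightarrow> real" where
  "killing X Y = (real CARD('p + 'q) - 2) * trace (X ** Y)"

text \<open>The normalized quadratic form; no square root is taken.\<close>

definition nrm :: "('p::finite, 'q::finite) mpq \<Rightarrow> real" where
  "nrm X = 1 / (2 * (real CARD('p + 'q) - 2)) * killing X X"

text \<open>The library product on the type \<open>real ^ 'n ^ 'n\<close> is entrywise, so \<open>exp\<close> is not available.\<close>

definition mexp :: "real ^ 'n ^ 'n \<Rightarrow> real ^ 'n ^ 'n" where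
  "mexp X = (\<Sum>k. (1 / fact k) *\<^sub>R (((**) X ^^ k) (mat 1)))"

definition pexp :: "real ^ 'n ^ 'n \<Rightarrow> (real ^ 'n ^ 'n) set" where
  "pexp X = psl_class (mexp X)"


subsection \<open>The pseudo-Riemannian hyperbolic space\<close>

text \<open>Points of the projective space are one-dimensional linear subspaces.\<close>

definition HH :: "('p::finite, 'q::finite) vpq set set" where
  "HH = {span {v} | v. form v v < 0}"

definition hyperboloid :: "('p::finite, 'q::finite) vpq set" where
  "hyperboloid = {v. form v v = -1}"

definition signature_1_1 :: "('p::finite, 'q::finite) vpq set \<Rightarrow> bool" where
  "signature_1_1 P \<longleftrightarrow> subspace P \<and> dim P = 2 \<and>
     (\<exists>u\<in>P. \<exists>v\<in>P. form u u > 0 \<and> form v v < 0 \<and> form u v = 0)"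

definition spacelike_geodesics :: "('p::finite, 'q::finite) vpq set set set" where
  "spacelike_geodesics = {{x \<in> HH. x \<subseteq> P} | P. signature_1_1 P}"

text \<open>A point lies on a space-like geodesic through itself, so \<open>pt \<in> CC pt\<close>.\<close>

definition CC :: "('p::finite, 'q::finite) vpq set \<Rightarrow> ('p, 'q) vpq set set" where
  "CC pt = {x \<in> HH. \<exists>\<gamma>\<in>spacelike_geodesics. pt \<in> \<gamma> \<and> x \<in> \<gamma>}"

definition CCG :: "('p::finite, 'q::finite) vpq set \<Rightarrow> ('p, 'q) mpq set set" where
  "CCG pt = {g \<in> PSO_pq. psl_act g pt \<in> CC pt}"

text \<open>
  \<open>c\<close> is a lift to the hyperboloid of an injective C1 parametrization, over \<open>{a..b}\<close>, of the
  segment of the geodesic \<open>\<gamma>\<close> from \<open>x\<close> to \<open>y\<close>. The case \<open>a = b\<close> gives the degenerate segment.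
\<close>

definition segment_lift ::
  "('p::finite, 'q::finite) vpq set set \<Rightarrow> ('p, 'q) vpq set \<Rightarrow> ('p, 'q) vpq set \<Rightarrow>
   real \<Rightarrow> real \<Rightarrow> (real \<Rightarrow> ('p, 'q) vpq) \<Rightarrow> bool" where
  "segment_lift \<gamma> x y a b c \<longleftrightarrow> a \<le> b \<and> c C1_differentiable_on {a..b} \<and> inj_on c {a..b} \<and>
     (\<forall>t\<in>{a..b}. c t \<in> hyperboloid \<and> span {c t} \<in> \<gamma>) \<and> span {c a} = x \<and> span {c b} = y"

text \<open>The metric at \<open>[c t]\<close> is the restriction of the form to the tangent space of the hyperboloid.\<close>

definition curve_length :: "real \<Rightarrow> real \<Rightarrow> (real \<Rightarrow> ('p::finite, 'q::finite) vpq) \<Rightarrow> real" where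
  "curve_length a b c = integral {a..b}
     (\<lambda>t. sqrt (form (vector_derivative c (at t)) (vector_derivative c (at t))))"

definition ell :: "('p::finite, 'q::finite) vpq set \<Rightarrow> ('p, 'q) vpq set \<Rightarrow> real" where
  "ell x y = (THE L. \<exists>\<gamma>\<in>spacelike_geodesics. \<exists>a b c.
     segment_lift \<gamma> x y a b c \<and> L = curve_length a b c)"

definition stabilizer :: "('p::finite, 'q::finite) vpq set \<Rightarrow> ('p, 'q) mpq set set" where
  "stabilizer pt = {g \<in> PSO_pq. psl_act g pt = pt}"

definition JJ :: "('p::finite, 'q::finite) vpq set \<Rightarrow> ('p, 'q) mpq" where
  "JJ pt = (THE J. (\<forall>x\<in>pt. J *v x = x) \<and> (\<forall>y\<in>perp pt. J *v y = - y))"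

definition qq :: "('p::finite, 'q::finite) vpq set \<Rightarrow> ('p, 'q) mpq set" where
  "qq pt = {X \<in> so_pq. JJ pt ** X ** JJ pt = - X}"


subsection \<open>The Riemannian symmetric space\<close>

definition XG :: "('p::finite, 'q::finite) vpq set set" where
  "XG = {\<tau>. subspace \<tau> \<and> dim \<tau> = CARD('q) \<and> (\<forall>x\<in>\<tau>. x \<noteq> 0 \<longrightarrow> form x x < 0)}"

definition SS :: "('p::finite, 'q::finite) vpq set \<Rightarrow> ('p, 'q) vpq set set" where
  "SS pt = {\<tau> \<in> XG. pt \<subseteq> \<tau>}"

definition ip :: "('p::finite, 'q::finite) vpq set \<Rightarrow> ('p, 'q) vpq \<Rightarrow> ('p, 'q) vpq \<Rightarrow> real" where
  "ip \<tau> x y = - form (proj \<tau> *v x) (proj \<tau> *v y)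
              + form (x - proj \<tau> *v x) (y - proj \<tau> *v y)"

definition pp :: "('p::finite, 'q::finite) vpq set \<Rightarrow> ('p, 'q) mpq set" where
  "pp \<tau> = {X \<in> so_pq. \<forall>x y. ip \<tau> (X *v x) y = ip \<tau> x (X *v y)}"

text \<open>
  The space \<open>XG\<close> is embedded into the space of matrices by \<open>\<tau> \<mapsto> proj \<tau>\<close>. Under this embedding
  \<open>X \<in> pp \<tau>\<close> corresponds to the tangent vector at \<open>s = 0\<close> of the curve \<open>exp (s X) \<tau>\<close>.
\<close>

definition tangent :: "('p::finite, 'q::finite) vpq set \<Rightarrow> ('p, 'q) mpq \<Rightarrow> ('p, 'q) mpq" where
  "tangent \<tau> X = vector_derivative (\<lambda>s. proj (psl_act (pexp (s *\<^sub>R X)) \<tau>)) (at 0)"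

text \<open>
  \<open>T\<close> is a C1 curve in \<open>XG\<close> over \<open>{0..1}\<close>, not necessarily regular, and \<open>X t \<in> pp (T t)\<close> is its
  velocity at time \<open>t\<close>.
\<close>

definition XG_curve ::
  "(real \<Rightarrow> ('p::finite, 'q::finite) vpq set) \<Rightarrow> (real \<Rightarrow> ('p, 'q) mpq) \<Rightarrow> bool" where
  "XG_curve T X \<longleftrightarrow> continuous_on {0..1} X \<and>
     (\<forall>t\<in>{0..1}. T t \<in> XG \<and> X t \<in> pp (T t) \<and>
        ((\<lambda>s. proj (T s)) has_vector_derivative tangent (T t) (X t)) (at t within {0..1}))"

text \<open>
  Distance of the G-invariant Riemannian metric whose norm on \<open>pp \<tau>\<close> is the square root of \<open>nrm\<close>.
  It is extended-real valued, so that no junk value can arise from an infimum over an empty set.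
\<close>

definition dXG :: "('p::finite, 'q::finite) vpq set \<Rightarrow> ('p, 'q) vpq set \<Rightarrow> ereal" where
  "dXG \<sigma> \<tau> = Inf {ereal (integral {0..1} (\<lambda>t. sqrt (nrm (X t)))) | T X.
     XG_curve T X \<and> T 0 = \<sigma> \<and> T 1 = \<tau>}"

definition dXG_set ::
  "('p::finite, 'q::finite) vpq set set \<Rightarrow> ('p, 'q) vpq set set \<Rightarrow> ereal" where
  "dXG_set A B = Inf {dXG a b | a b. a \<in> A \<and> b \<in> B}"


subsection \<open>Weyl chambers and the associated projection\<close>

definition lie_subalgebra :: "('p::finite, 'q::finite) mpq set \<Rightarrow> bool" where
  "lie_subalgebra B \<longleftrightarrow> subspace B \<and> B \<subseteq> so_pq \<and> (\<forall>X\<in>B. \<forall>Y\<in>B. X ** Y - Y ** X \<in> B)"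

definition maximal_subalgebra_in ::
  "('p::finite, 'q::finite) mpq set \<Rightarrow> ('p, 'q) mpq set \<Rightarrow> bool" where
  "maximal_subalgebra_in B V \<longleftrightarrow> lie_subalgebra B \<and> B \<subseteq> V \<and>
     (\<forall>B'. lie_subalgebra B' \<and> B' \<subseteq> V \<and> B \<subseteq> B' \<longrightarrow> B' = B)"

definition closed_weyl_chamber ::
  "('p::finite, 'q::finite) mpq set \<Rightarrow> ('p, 'q) mpq set \<Rightarrow> bool" where
  "closed_weyl_chamber B C \<longleftrightarrow> (\<exists>X\<in>B. X \<noteq> 0 \<and> C = {s *\<^sub>R X | s. s \<ge> 0})"

text \<open>The projection \<open>b\<^sup>o\<close> onto the closed Weyl chamber \<open>C\<close>.\<close>

definition bb ::
  "('p::finite, 'q::finite) vpq set \<Rightarrow> ('p, 'q) mpq set \<Rightarrow> ('p, 'q) mpq set \<Rightarrow> ('p, 'q) mpq" where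
  "bb pt C g = (THE X. X \<in> C \<and>
     (\<exists>h\<in>stabilizer pt. \<exists>h'\<in>stabilizer pt. g = psl_mult (psl_mult h (pexp X)) h'))"

end

theory Submission
  imports Defs
begin

text \<open>
  Write \<open>pt = span {e}\<close> and \<open>g pt = span {cosh s e + sinh s u}\<close> with \<open>form e e = -1\<close>,
  \<open>form u u = 1\<close>, \<open>form e u = 0\<close> and \<open>s \<ge> 0\<close>; all three quantities equal \<open>s\<close>. A chamber is a half-line
  spanned by an infinitesimal transvection \<open>X\<close> with \<open>X e = w\<close>, \<open>X w = e\<close> for some unit vector \<open>w\<close> orthogonal to
  \<open>\<tau>\<close>, and some \<open>h \<in> SO(p,q)\<close> fixes \<open>e\<close> and maps \<open>w\<close> to \<open>u\<close>; as \<open>form e (g e)\<close> determines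
  \<open>s\<close>, the projection of \<open>g\<close> is \<open>s X\<close>. The curve \<open>exp (t s h X h\<^sup>-\<^sup>1) h \<tau>\<close> gives the upper bound for
  the distance. For the lower bound, \<open>e - u\<close> and \<open>e + u\<close> are isotropic, and half the logarithm of
  \<open>ip \<sigma> n n\<close> is a 1-Lipschitz function of \<open>\<sigma>\<close> for each \<open>n\<close> (a Busemann function if \<open>n\<close> is isotropic). The
  half-difference of these functions for \<open>e - u\<close> and \<open>e + u\<close> is therefore 1-Lipschitz; it vanishes on
  the subspaces containing \<open>pt\<close> and equals \<open>s\<close> on those containing \<open>g pt\<close>.
\<close>

subsection \<open>Adjoints and orthogonal matrices\<close>

definition sgn_mat :: "('p::finite, 'q::finite) mpq" where
  "sgn_mat = (\<chi> i j. if i = j then (case i of Inl _ \<Rightarrow> 1 | Inr _ \<Rightarrow> -1) else 0)"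

text \<open>The adjoint with respect to \<open>form\<close>, whose Gram matrix is
  \<open>sgn_mat\<close>. It turns the isometry condition into \<open>adj A ** A = mat 1\<close> and
  membership in \<open>so_pq\<close> into \<open>adj X = - X\<close>.\<close>

definition adj :: "('p::finite, 'q::finite) mpq \<Rightarrow> ('p, 'q) mpq" where
  "adj A = sgn_mat ** transpose A ** sgn_mat"

text \<open>The determinant is left free because reflections, the building blocks below, have
  determinant -1; it is corrected only where \<open>SO_pq\<close> is required.\<close>

definition O_pq :: "('p::finite, 'q::finite) mpq set" where
  "O_pq = {A. \<forall>x y. form (A *v x) (A *v y) = form x y}"

definition outer :: "real ^ 'n \<Rightarrow> real ^ 'm \<Rightarrow> real ^ 'm ^ 'n" where
  "outer a b = (\<chi> i j. a $ i * b $ j)"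

lemma transpose_sgn_mat [simp]: "transpose sgn_mat = sgn_mat"
  by (auto simp: sgn_mat_def transpose_def vec_eq_iff)

lemma sgn_mat_mult_vec: "(sgn_mat *v x) $ i = (case i of Inl _ \<Rightarrow> x $ i | Inr _ \<Rightarrow> - x $ i)"
proof -
  have "(sgn_mat *v x) $ i = (\<Sum>j\<in>UNIV. if j = i then (case i of Inl _ \<Rightarrow> 1 | Inr _ \<Rightarrow> -1) * x $ i else 0)"
    unfolding sgn_mat_def matrix_vector_mult_def vec_lambda_beta by (rule sum.cong) auto
  also have "\<dots> = (case i of Inl _ \<Rightarrow> 1 | Inr _ \<Rightarrow> -1) * x $ i"
    by (simp only: sum.delta finite UNIV_I if_True)
  finally show ?thesis by (auto split: sum.splits)
qed

lemma sgn_mat_involution [simp]: "sgn_mat *v (sgn_mat *v x) = x"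
  by (auto simp: vec_eq_iff sgn_mat_mult_vec split: sum.splits)

lemma sgn_mat_sgn_mat [simp]: "sgn_mat ** sgn_mat = mat 1"
  by (simp add: matrix_eq flip: matrix_vector_mul_assoc)

lemma form_inner: "form x y = x \<bullet> (sgn_mat *v y)"
proof -
  have "x \<bullet> (sgn_mat *v y) = (\<Sum>i\<in>UNIV <+> UNIV. x $ i * (sgn_mat *v y) $ i)"
    by (simp add: inner_vec_def)
  also have "\<dots> = form x y"
    by (subst sum.Plus) (auto simp: form_def sgn_mat_mult_vec sum_negf)
  finally show ?thesis by simp
qed

lemma inner_transpose: "(A *v x) \<bullet> y = x \<bullet> (transpose A *v y)" for A :: "real ^ 'n ^ 'm"
  by (metis dot_lmul_matrix inner_commute transpose_matrix_vector transpose_transpose)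

lemma inner_sgn_mat: "(sgn_mat *v x) \<bullet> y = x \<bullet> (sgn_mat *v y)"
  by (simp add: inner_transpose)

lemma form_commute: "form x y = form y x"
  by (simp add: form_def mult.commute)

lemma bounded_bilinear_matrix_mult:
  "bounded_bilinear ((**) :: real ^ 'n ^ 'm \<Rightarrow> real ^ 'k ^ 'n \<Rightarrow> real ^ 'k ^ 'm)"
  unfolding bilinear_conv_bounded_bilinear[symmetric] bilinear_def
  by (intro conjI allI linearI)
     (auto simp: matrix_matrix_mult_def vec_eq_iff algebra_simps sum.distrib sum_distrib_left)

lemma bounded_bilinear_matrix_vector_mult:
  "bounded_bilinear ((*v) :: real ^ 'n ^ 'm \<Rightarrow> real ^ 'n \<Rightarrow> real ^ 'm)"
  unfolding bilinear_conv_bounded_bilinear[symmetric] bilinear_def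
  by (intro conjI allI linearI)
     (auto simp: matrix_vector_mult_def vec_eq_iff algebra_simps sum.distrib sum_distrib_left)

lemma bounded_bilinear_form: "bounded_bilinear form"
  unfolding bilinear_conv_bounded_bilinear[symmetric] bilinear_def
  by (intro conjI allI linearI)
     (auto simp: form_inner inner_add_left inner_add_right matrix_vector_right_distrib
        matrix_vector_mult_scaleR)

interpretation form: bounded_bilinear form by (rule bounded_bilinear_form)
interpretation mm: bounded_bilinear "(**) :: real ^ 'n ^ 'm \<Rightarrow> real ^ 'k ^ 'n \<Rightarrow> real ^ 'k ^ 'm"
  by (rule bounded_bilinear_matrix_mult)
interpretation mv: bounded_bilinear "(*v) :: real ^ 'n ^ 'm \<Rightarrow> real ^ 'n \<Rightarrow> real ^ 'm"
  by (rule bounded_bilinear_matrix_vector_mult)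

lemmas form_simps = form.add_left form.add_right form.diff_left form.diff_right
  form.minus_left form.minus_right form.scaleR_left form.scaleR_right form.zero_left form.zero_right

lemmas mv_simps = mv.add_left mv.add_right mv.diff_left mv.diff_right
  mv.minus_left mv.minus_right mv.scaleR_left mv.scaleR_right mv.zero_left mv.zero_right

text \<open>Nondegeneracy of \<open>form\<close>, inherited from the Euclidean inner product because
  \<open>sgn_mat\<close> is invertible.\<close>

lemma form_eqI:
  assumes "\<And>x. form x y = form x z"
  shows "y = z"
proof -
  have "x \<bullet> (sgn_mat *v y) = x \<bullet> (sgn_mat *v z)" for x using assms form_inner by metis
  then have "sgn_mat *v y = sgn_mat *v z" by (metis vector_eq_ldot)
  then show ?thesis by (metis sgn_mat_involution)
qed

lemma form_adj: "form (A *v x) y = form x (adj A *v y)"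
  by (simp add: form_inner adj_def inner_transpose flip: matrix_vector_mul_assoc)

lemma adj_adj [simp]: "adj (adj A) = A"
proof -
  have "adj (adj A) = (sgn_mat ** sgn_mat) ** A ** (sgn_mat ** sgn_mat)"
    unfolding adj_def by (simp only: matrix_transpose_mul transpose_transpose transpose_sgn_mat matrix_mul_assoc)
  then show ?thesis by simp
qed

lemma adj_mult: "adj (A ** B) = adj B ** adj A"
proof -
  have "adj B ** adj A = sgn_mat ** transpose B ** (sgn_mat ** sgn_mat) ** transpose A ** sgn_mat"
    unfolding adj_def by (simp only: matrix_mul_assoc)
  then show ?thesis by (simp add: adj_def matrix_transpose_mul matrix_mul_assoc)
qed

lemma bounded_linear_adj: "bounded_linear adj"
proof -
  have "linear (adj :: ('a, 'b) mpq \<Rightarrow> _)"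
  proof (rule linearI)
    show "adj (A + B) = adj A + adj B" for A B :: "('a, 'b) mpq"
    proof -
      have "transpose (A + B) = transpose A + transpose B"
        by (simp add: transpose_def vec_eq_iff)
      then show ?thesis by (simp add: adj_def mm.add_left mm.add_right)
    qed
    show "adj (r *\<^sub>R A) = r *\<^sub>R adj A" for A :: "('a, 'b) mpq" and r
      by (simp add: adj_def mm.scaleR_left mm.scaleR_right transpose_scalar)
  qed
  then show ?thesis by (simp add: linear_conv_bounded_linear)
qed

lemma matrix_eqI: "(\<And>x. A *v x = B *v x) \<Longrightarrow> A = B" for A B :: "real ^ 'n ^ 'm"
  by (simp add: matrix_eq)

lemma adj_eqI:
  assumes "\<And>x y. form (A *v x) y = form x (B *v y)"
  shows "adj A = B"
  by (rule matrix_eqI, rule form_eqI) (metis assms form_adj)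

section \<open>Isometries and skew matrices of the form\<close>

lemma O_pq_iff: "A \<in> O_pq \<longleftrightarrow> adj A ** A = mat 1"
proof
  assume A: "A \<in> O_pq"
  show "adj A ** A = mat 1"
  proof (rule matrix_eqI, rule form_eqI)
    fix x y
    show "form y (adj A ** A *v x) = form y (mat 1 *v x)"
      using A by (simp add: O_pq_def form_adj flip: matrix_vector_mul_assoc)
  qed
next
  assume "adj A ** A = mat 1"
  then show "A \<in> O_pq"
    by (simp add: O_pq_def form_adj matrix_vector_mul_assoc)
qed

lemma O_pq_form: "A \<in> O_pq \<Longrightarrow> form (A *v x) (A *v y) = form x y"
  by (simp add: O_pq_def)

lemma O_pq_inv:
  assumes "A \<in> O_pq"
  shows "adj A ** A = mat 1" "A ** adj A = mat 1" "adj A *v (A *v x) = x" "A *v (adj A *v x) = x"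
proof -
  show 1: "adj A ** A = mat 1" using assms O_pq_iff by blast
  then show 2: "A ** adj A = mat 1" by (simp add: matrix_left_right_inverse)
  show "adj A *v (A *v x) = x" "A *v (adj A *v x) = x"
    by (simp_all add: matrix_vector_mul_assoc 1 2)
qed

lemma O_pq_mult: "A \<in> O_pq \<Longrightarrow> B \<in> O_pq \<Longrightarrow> A ** B \<in> O_pq"
  by (simp add: O_pq_def flip: matrix_vector_mul_assoc)

lemma O_pq_adj: "A \<in> O_pq \<Longrightarrow> adj A \<in> O_pq"
  by (simp add: O_pq_iff O_pq_inv)

lemma O_pq_one: "mat 1 \<in> O_pq"
  by (simp add: O_pq_def)

text \<open>\<open>adj\<close> multiplies by \<open>sgn_mat\<close> on both sides, so the sign of
  its determinant cancels.\<close>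

lemma det_sgn_mat: "det (sgn_mat :: ('p::finite, 'q::finite) mpq) ^ 2 = 1"
  by (simp add: power2_eq_square flip: det_mul)

lemma det_O_pq_sq:
  assumes "A \<in> O_pq"
  shows "det A ^ 2 = 1"
proof -
  have "det (adj A) * det A = 1"
    using O_pq_inv(1)[OF assms] by (metis det_I det_mul)
  moreover have "det (adj A) = det A * det (sgn_mat :: ('a, 'b) mpq) ^ 2"
    by (simp add: adj_def det_mul power2_eq_square)
  ultimately show ?thesis
    using det_sgn_mat[where 'p='a and 'q='b] by (simp add: power2_eq_square)
qed

lemma det_O_pq: "A \<in> O_pq \<Longrightarrow> det A = 1 \<or> det A = -1"
  using det_O_pq_sq power2_eq_1_iff by blast

lemma det_adj: "A \<in> O_pq \<Longrightarrow> det (adj A) = det A"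
  using det_sgn_mat[where 'p='a and 'q='b] by (simp add: adj_def det_mul power2_eq_square)

lemma SO_pq_iff: "A \<in> SO_pq \<longleftrightarrow> A \<in> O_pq \<and> det A = 1"
  by (auto simp: SO_pq_def O_pq_def)

lemma so_pq_iff: "X \<in> so_pq \<longleftrightarrow> adj X = - X"
proof
  assume X: "X \<in> so_pq"
  show "adj X = - X"
  proof (rule adj_eqI)
    fix x y
    have "form (X *v x) y + form x (X *v y) = 0" using X by (simp add: so_pq_def)
    then show "form (X *v x) y = form x (- X *v y)" by (simp add: mv.minus_left form.minus_right)
  qed
next
  assume "adj X = - X"
  then show "X \<in> so_pq" by (simp add: so_pq_def form_adj mv.minus_left form.minus_right)
qed

lemma so_pq_skew: "X \<in> so_pq \<Longrightarrow> form (X *v x) y = - form x (X *v y)"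
  by (simp add: so_pq_def add_eq_0_iff)

lemma so_pq_skew_self: "X \<in> so_pq \<Longrightarrow> form (X *v x) x = 0"
  using so_pq_skew[of X x x] by (simp add: form_commute)

subsection \<open>Reflections\<close>

lemma outer_mult_vec: "outer a b *v x = (b \<bullet> x) *\<^sub>R a"
  by (simp add: outer_def matrix_vector_mult_def vec_eq_iff inner_vec_def mult.commute
      mult.left_commute sum_distrib_left)

text \<open>The \<open>outer\<close> term is the matrix sending \<open>x\<close> to
  \<open>form a x\<close> times \<open>a\<close>. For isotropic \<open>a\<close> the coefficient is
  a division by 0, and the matrix is the identity.\<close>

definition reflection :: "('p::finite, 'q::finite) vpq \<Rightarrow> ('p, 'q) mpq" where
  "reflection a = mat 1 - (2 / form a a) *\<^sub>R outer a (sgn_mat *v a)"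

lemma reflection_mult_vec: "reflection a *v x = x - (2 * form a x / form a a) *\<^sub>R a"
  by (simp add: reflection_def mv_simps outer_mult_vec inner_sgn_mat form_inner)

lemma reflection_O_pq: "form a a \<noteq> 0 \<Longrightarrow> reflection a \<in> O_pq"
  by (simp add: O_pq_def reflection_mult_vec form_simps form_commute field_simps)

lemma reflection_orth: "form a x = 0 \<Longrightarrow> reflection a *v x = x"
  by (simp add: reflection_mult_vec)

text \<open>Equal squares give \<open>form (u - v) (u - v) = 2 * form (u - v) u\<close>, so exactly
  one copy of \<open>u - v\<close> is subtracted from \<open>u\<close>.\<close>

lemma reflection_swap:
  assumes "form u u = form v v" "form (u - v) (u - v) \<noteq> 0"
  shows "reflection (u - v) *v u = v"
proof -
  have "form (u - v) (u - v) = 2 * form (u - v) u"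
    using assms(1) by (simp add: form_simps form_commute)
  then have "2 * form (u - v) u / form (u - v) (u - v) = 1" using assms(2) by simp
  then show ?thesis by (simp add: reflection_mult_vec)
qed

lemma reflection_scaleR: "k \<noteq> 0 \<Longrightarrow> reflection (k *\<^sub>R a) = reflection a"
  by (rule matrix_eqI) (simp add: reflection_mult_vec form_simps)

text \<open>One of \<open>u - v\<close> and \<open>u + v\<close> is not isotropic, because
  \<open>form (u - v) (u - v) + form (u + v) (u + v) = 4 * form u u\<close>.\<close>

lemma reflection_exists:
  assumes "form u u = form v v" "form u u \<noteq> 0"
  obtains A where "A \<in> O_pq" "A *v u = v \<or> A *v u = - v"
    "\<And>x. form x u = 0 \<Longrightarrow> form x v = 0 \<Longrightarrow> A *v x = x"
proof (cases "form (u - v) (u - v) = 0")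
  case False
  show ?thesis
    by (rule that[of "reflection (u - v)"])
      (use False assms in \<open>auto simp: reflection_O_pq reflection_swap form_simps form_commute intro!: reflection_orth\<close>)
next
  case True
  \<comment> \<open>The sum is written as a difference so that \<open>reflection_swap\<close>
    applies to \<open>u\<close> and \<open>- v\<close>.\<close>
  have n: "form (u - (- v)) (u - (- v)) \<noteq> 0"
    using True assms by (simp add: form_simps form_commute)
  show ?thesis
  proof (rule that[of "reflection (u - (- v))"])
    show "reflection (u - (- v)) *v u = v \<or> reflection (u - (- v)) *v u = - v"
      using reflection_swap[OF _ n] assms by (simp add: form_simps)
  qed (use n in \<open>auto simp: reflection_O_pq form_simps form_commute intro!: reflection_orth\<close>)
qed

text \<open>The sign left open above is removed by a further reflection in \<open>v\<close>, which
  sends \<open>- v\<close> to \<open>v\<close> and fixes everything orthogonal to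
  \<open>v\<close>.\<close>

lemma reflection_exists':
  assumes "form u u = form v v" "form u u \<noteq> 0"
  obtains A where "A \<in> O_pq" "A *v u = v"
    "\<And>x. form x u = 0 \<Longrightarrow> form x v = 0 \<Longrightarrow> A *v x = x"
proof -
  obtain A where A: "A \<in> O_pq" "A *v u = v \<or> A *v u = - v"
    "\<And>x. form x u = 0 \<Longrightarrow> form x v = 0 \<Longrightarrow> A *v x = x"
    using reflection_exists[OF assms] by blast
  show ?thesis
  proof (cases "A *v u = v")
    case True
    then show ?thesis using A that by blast
  next
    case False
    have v: "form v v \<noteq> 0" using assms by simp
    have "reflection v *v (- v) = v"
      using v by (simp add: reflection_mult_vec form_simps) (metis mult_2 scaleR_2 add_diff_cancel_left')
    show ?thesis
    proof (rule that[of "reflection v ** A"])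
      show "reflection v ** A \<in> O_pq" using A(1) v by (simp add: O_pq_mult reflection_O_pq)
      show "reflection v ** A *v u = v"
        using A(2) False \<open>reflection v *v (- v) = v\<close> by (simp flip: matrix_vector_mul_assoc)
      show "reflection v ** A *v x = x" if "form x u = 0" "form x v = 0" for x
        using A(3)[OF that] that by (simp add: reflection_orth form_commute flip: matrix_vector_mul_assoc)
    qed
  qed
qed

lemma sgn_mat_axis: "sgn_mat *v axis i 1 = (case i of Inl _ \<Rightarrow> 1 | Inr _ \<Rightarrow> -1) *\<^sub>R axis i 1"
  by (auto simp: vec_eq_iff sgn_mat_mult_vec axis_def split: sum.splits)

lemma form_axis: "form x (axis i 1) = (case i of Inl _ \<Rightarrow> 1 | Inr _ \<Rightarrow> -1) * x $ i"
  by (simp add: form_inner sgn_mat_axis inner_axis)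

lemma form_axis_Inr: "form x (axis (Inr j) 1) = - x $ Inr j"
  by (simp add: form_axis)

lemma axis_mult: "axis i (1::real) $ j = (if i = j then 1 else 0)"
  by (simp add: axis_def)

lemma det_reflection_axis: "det (reflection (axis i 1) :: ('p::finite, 'q::finite) mpq) = -1"
proof -
  let ?R = "reflection (axis i 1) :: ('p, 'q) mpq"
  have R: "?R $ k $ l = (if k = l then (if k = i then -1 else 1) else 0)" for k l
    by (simp add: reflection_def outer_def sgn_mat_axis form_axis mat_def axis_mult split: sum.split)
  have "det ?R = (\<Prod>k\<in>UNIV. ?R $ k $ k)" by (rule det_diagonal) (simp add: R)
  also have "\<dots> = (\<Prod>k\<in>UNIV. if k = i then -1 else 1)"
    unfolding R by (rule prod.cong) auto
  also have "\<dots> = -1" by (subst prod.delta) auto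
  finally show ?thesis .
qed

text \<open>A reflection is conjugate to a diagonal matrix with one entry \<open>-1\<close>.\<close>

lemma det_reflection:
  fixes a :: "('p::finite, 'q::finite) vpq"
  assumes "form a a \<noteq> 0"
  shows "det (reflection a) = -1"
proof -
  \<comment> \<open>Scaling \<open>a\<close> does not change its reflection. The axis
    \<open>i\<close> is chosen with the sign of \<open>form a a\<close>, so that some isometry maps
    it to the normalized vector \<open>b\<close>.\<close>
  define b where "b = (1 / sqrt \<bar>form a a\<bar>) *\<^sub>R a"
  define i :: "'p + 'q" where "i = (if form a a > 0 then Inl undefined else Inr undefined)"
  let ?e = "axis i 1 :: ('p, 'q) vpq"
  have e: "form ?e ?e \<noteq> 0" by (simp add: form_axis axis_mult i_def)
  have b: "form b b = form ?e ?e"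
    using assms by (auto simp: b_def form_simps form_axis axis_mult i_def field_simps)
  obtain A where A: "A \<in> O_pq" "A *v ?e = b" using reflection_exists'[of ?e b] b e by auto
  have "reflection a ** A = A ** reflection ?e"
  proof (rule matrix_eqI)
    fix x
    have "reflection a *v y = reflection b *v y" for y
      using assms by (simp add: b_def reflection_scaleR)
    moreover have "form b (A *v x) = form ?e x" using O_pq_form[OF A(1), of ?e x] A(2) by simp
    ultimately show "reflection a ** A *v x = A ** reflection ?e *v x"
      using A(2) b by (simp add: reflection_mult_vec mv_simps flip: matrix_vector_mul_assoc)
  qed
  then have "det (reflection a) * det A = -1 * det A" by (metis det_mul det_reflection_axis mult.commute)
  moreover have "det A \<noteq> 0" using det_O_pq[OF A(1)] by auto
  ultimately show ?thesis by (metis mult_right_cancel)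
qed

text \<open>If every vector orthogonal to \<open>e\<close> and \<open>u\<close> were isotropic,
  polarization would make the form vanish on that complement; nondegeneracy then makes the
  complement zero, and the whole space would be spanned by \<open>e\<close> and
  \<open>u\<close>.\<close>

lemma anisotropic_orth:
  fixes e u :: "('p::finite, 'q::finite) vpq"
  assumes d: "CARD('p) + CARD('q) > 2"
    and "form e e = -1" "form u u = 1" "form e u = 0"
  obtains f where "form f f \<noteq> 0" "form e f = 0" "form u f = 0"
proof (rule ccontr)
  assume no: "\<not> thesis"
  \<comment> \<open>The projection onto the complement of \<open>e\<close> and \<open>u\<close>; the
    signs come from \<open>form e e = -1\<close> and \<open>form u u = 1\<close>.\<close>
  define c where "c x = x + form x e *\<^sub>R e - form x u *\<^sub>R u" for x
  have orth: "form e (c x) = 0" "form u (c x) = 0" for x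
    using assms(2-4) by (simp_all add: c_def form_simps form_commute)
  have iso: "form (c x) (c x) = 0" for x using no that orth by blast
  have "form (c x) y = 0" for x y
  proof -
    have "form (c x) y = form (c x) (c y)"
      using orth[of x] by (simp add: c_def[of y] form_simps form_commute)
    also have "\<dots> = (form (c (x + y)) (c (x + y)) - form (c x) (c x) - form (c y) (c y)) / 2"
    proof -
      have "c (x + y) = c x + c y" by (simp add: c_def form_simps algebra_simps)
      then show ?thesis by (simp only: form.add_left form.add_right form_commute[of "c y" "c x"]) simp
    qed
    finally show ?thesis by (simp add: iso)
  qed
  then have "c x = 0" for x
    by (intro form_eqI[of "c x" 0]) (simp add: form_commute[of _ "c x"] form.zero_right)
  then have "form x u *\<^sub>R u - form x e *\<^sub>R e = x" for x
    unfolding c_def by (metis add_diff_cancel_right' eq_iff_diff_eq_0)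
  moreover have "form x u *\<^sub>R u - form x e *\<^sub>R e \<in> span {e, u}" for x
    by (intro span_diff span_scale span_base) auto
  ultimately have "x \<in> span {e, u}" for x by metis
  then have "span {e, u} = UNIV" by blast
  then have "dim (UNIV :: ('p, 'q) vpq set) \<le> card {e, u}"
    by (metis dim_le_card finite.emptyI finite.insertI order_refl)
  moreover have "card {e, u} \<le> 2" by (simp add: card_insert_le_m1)
  ultimately show False using d by simp
qed

text \<open>An isometry moving \<open>u\<close> to \<open>v\<close> and fixing \<open>e\<close> may
  have determinant -1. Composing it with the reflection in an anisotropic vector orthogonal to
  \<open>e\<close> and \<open>v\<close> corrects this without disturbing either.\<close>

lemma SO_pq_transitive:
  fixes e u v :: "('p::finite, 'q::finite) vpq"
  assumes "CARD('p) + CARD('q) > 2"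
    and e: "form e e = -1" and u: "form u u = 1" "form e u = 0" and v: "form v v = 1" "form e v = 0"
  obtains A where "A \<in> SO_pq" "A *v e = e" "A *v u = v"
proof -
  obtain A where A: "A \<in> O_pq" "A *v u = v"
    "\<And>x. form x u = 0 \<Longrightarrow> form x v = 0 \<Longrightarrow> A *v x = x"
    using reflection_exists'[of u v] u v by auto
  have Ae: "A *v e = e" using A(3) u v by simp
  show ?thesis
  proof (cases "det A = 1")
    case True
    then show ?thesis using that[of A] A Ae by (simp add: SO_pq_iff)
  next
    case False
    then have d: "det A = -1" using det_O_pq[OF A(1)] by simp
    obtain f where f: "form f f \<noteq> 0" "form e f = 0" "form v f = 0"
      using anisotropic_orth[OF assms(1) e v] .
    show ?thesis
    proof (rule that[of "reflection f ** A"])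
      show "reflection f ** A \<in> SO_pq"
        using f(1) A(1) d by (simp add: SO_pq_iff O_pq_mult reflection_O_pq det_mul det_reflection)
      show "reflection f ** A *v e = e" "reflection f ** A *v u = v"
        using f(2,3) A(2) Ae by (simp_all add: reflection_orth form_commute flip: matrix_vector_mul_assoc)
    qed
  qed
qed

subsection \<open>Negative definite subspaces\<close>

text \<open>The last two conditions split each vector into a part in \<tau> and a part in
  \<open>perp \<tau>\<close>. This is what makes the description in \<open>proj\<close> determine a
  unique matrix.\<close>

definition is_proj :: "('p::finite, 'q::finite) vpq set \<Rightarrow> ('p, 'q) mpq \<Rightarrow> bool" where
  "is_proj \<tau> P \<longleftrightarrow> (\<forall>x\<in>\<tau>. P *v x = x) \<and> (\<forall>y\<in>perp \<tau>. P *v y = 0) \<and>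
     (\<forall>x. P *v x \<in> \<tau>) \<and> (\<forall>x. x - P *v x \<in> perp \<tau>)"

lemma proj_eq:
  assumes "is_proj \<tau> P"
  shows "proj \<tau> = P"
  unfolding proj_def
proof (rule the_equality)
  show "(\<forall>x\<in>\<tau>. P *v x = x) \<and> (\<forall>y\<in>perp \<tau>. P *v y = 0)"
    using assms by (simp add: is_proj_def)
next
  fix Q assume Q: "(\<forall>x\<in>\<tau>. Q *v x = x) \<and> (\<forall>y\<in>perp \<tau>. Q *v y = 0)"
  show "Q = P"
  proof (rule matrix_eqI)
    fix x
    have "Q *v x = Q *v (P *v x) + Q *v (x - P *v x)" by (simp add: mv.diff_right)
    then show "Q *v x = P *v x" using assms Q by (auto simp: is_proj_def)
  qed
qed

text \<open>A vector is orthogonal to the image of \<tau> exactly when its image under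
  \<open>adj A\<close> is orthogonal to \<tau>.\<close>

lemma is_proj_image:
  assumes "A \<in> O_pq" "is_proj \<tau> P"
  shows "is_proj ((*v) A ` \<tau>) (A ** P ** adj A)"
proof -
  have perp: "y \<in> perp ((*v) A ` \<tau>) \<longleftrightarrow> adj A *v y \<in> perp \<tau>" for y
    by (auto simp: perp_def form_adj)
  show ?thesis
    unfolding is_proj_def Ball_def perp
    using assms(2) O_pq_inv[OF assms(1)]
    by (auto simp: is_proj_def mv.diff_right simp flip: matrix_vector_mul_assoc)
qed

text \<open>The base point of the symmetric space: there \<open>ip\<close> is the Euclidean inner
  product.\<close>

definition std_neg :: "('p::finite, 'q::finite) vpq set" where
  "std_neg = {x. \<forall>i. x $ Inl i = 0}"

lemma form_std_neg: "x \<in> std_neg \<Longrightarrow> form x y = - (\<Sum>j\<in>UNIV. x $ Inr j * y $ Inr j)"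
  by (simp add: form_def std_neg_def)

lemma axis_std_neg: "axis (Inr j) 1 \<in> std_neg"
  by (simp add: std_neg_def axis_def)

lemma std_neg_perp: "y \<in> perp std_neg \<Longrightarrow> y $ Inr j = 0"
  using form_axis_Inr[of y j] axis_std_neg[of j] by (auto simp: perp_def form_commute)

lemma is_proj_std_neg: "is_proj std_neg ((1/2) *\<^sub>R (mat 1 - sgn_mat))"
proof -
  have P: "(((1/2) *\<^sub>R (mat 1 - sgn_mat)) *v x) $ i = (case i of Inl _ \<Rightarrow> 0 | Inr _ \<Rightarrow> x $ i)"
    for x :: "('a, 'b) vpq" and i
    by (auto simp: mv_simps sgn_mat_mult_vec split: sum.splits)
  show ?thesis
    unfolding is_proj_def
  proof (intro conjI ballI allI)
    fix x :: "('a, 'b) vpq"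
    show "((1/2) *\<^sub>R (mat 1 - sgn_mat)) *v x = x" if "x \<in> std_neg"
      using that by (auto simp: vec_eq_iff P std_neg_def split: sum.splits)
    show "((1/2) *\<^sub>R (mat 1 - sgn_mat)) *v x = 0" if "x \<in> perp std_neg"
      using std_neg_perp[OF that] by (auto simp: vec_eq_iff P split: sum.splits)
    show "((1/2) *\<^sub>R (mat 1 - sgn_mat)) *v x \<in> std_neg"
      by (simp add: std_neg_def P)
    show "x - ((1/2) *\<^sub>R (mat 1 - sgn_mat)) *v x \<in> perp std_neg"
      by (auto simp: perp_def form_std_neg P)
  qed
qed

lemma inj_O_pq: "A \<in> O_pq \<Longrightarrow> inj ((*v) A)"
  by (metis O_pq_inv(3) injI)

lemma XG_image:
  assumes "A \<in> O_pq" "\<tau> \<in> XG"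
  shows "(*v) A ` \<tau> \<in> XG"
proof -
  have "subspace ((*v) A ` \<tau>)"
    using assms(2) by (auto simp: XG_def intro: linear_subspace_image)
  moreover have "dim ((*v) A ` \<tau>) = dim \<tau>"
    by (rule dim_image_eq) (auto intro: inj_on_subset[OF inj_O_pq[OF assms(1)]])
  moreover have "form (A *v x) (A *v x) < 0" if "x \<in> \<tau>" "A *v x \<noteq> 0" for x
    using that assms by (auto simp: XG_def O_pq_form)
  ultimately show ?thesis using assms(2) by (auto simp: XG_def)
qed

text \<open>Gram-Schmidt with isometries: the negative axes are brought into the subspace one at a
  time, by reflections that leave the axes already reached where they are.\<close>

lemma axes_in_image:
  fixes \<tau> :: "('p::finite, 'q::finite) vpq set"
  assumes "finite J" "\<tau> \<in> XG"
  shows "\<exists>A\<in>O_pq. \<forall>j\<in>J. axis (Inr j) 1 \<in> (*v) A ` \<tau>"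
  using assms(1)
proof (induction J)
  case empty
  then show ?case using O_pq_one by blast
next
  case (insert j J)
  then obtain A where A: "A \<in> O_pq" "\<forall>k\<in>J. axis (Inr k) 1 \<in> (*v) A ` \<tau>" by blast
  let ?\<sigma> = "(*v) A ` \<tau>"
  have \<sigma>: "?\<sigma> \<in> XG" using A(1) assms(2) by (rule XG_image)
  then have sub: "subspace ?\<sigma>" by (simp add: XG_def)
  let ?L = "(\<lambda>k. axis (Inr k) 1 :: ('p, 'q) vpq) ` J"
  \<comment> \<open>The axes in \<open>J\<close> are too few to span the image of \<tau>, which
    therefore contains a vector outside their span. Removing its components along these axes leaves
    the negative vector \<open>a\<close>.\<close>
  have "card J < CARD('q)" using insert(2) by (metis UNIV_I finite psubset_card_mono psubsetI subset_UNIV)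
  moreover have "dim ?L \<le> card J"
    using insert(1) by (meson card_image_le dim_le_card' finite_imageI le_trans)
  ultimately have "dim (span ?L) < dim ?\<sigma>" using \<sigma> by (simp add: XG_def)
  then have "\<not> ?\<sigma> \<subseteq> span ?L" by (meson dim_subset not_le)
  then obtain x where x: "x \<in> ?\<sigma>" "x \<notin> span ?L" by blast
  define a where "a = x - (\<Sum>k\<in>J. x $ Inr k *\<^sub>R axis (Inr k) 1)"
  have aJ: "a $ Inr k = 0" if "k \<in> J" for k
  proof -
    have "(\<Sum>i\<in>J. x $ Inr i *\<^sub>R axis (Inr i) 1 :: ('p, 'q) vpq) $ Inr k
        = (\<Sum>i\<in>J. if i = k then x $ Inr i else 0)"
      unfolding sum_component by (rule sum.cong) (auto simp: axis_def)
    then show ?thesis using that insert(1) by (simp add: a_def)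
  qed
  have a\<sigma>: "a \<in> ?\<sigma>"
    unfolding a_def using x(1) A(2) sub
    by (intro subspace_diff subspace_sum subspace_scale) auto
  have "(\<Sum>k\<in>J. x $ Inr k *\<^sub>R axis (Inr k) 1) \<in> span ?L"
    by (intro span_sum span_scale span_base) auto
  then have "a \<noteq> 0" using x(2) by (auto simp: a_def)
  then have neg: "form a a < 0" using \<sigma> a\<sigma> unfolding XG_def by blast
  define b where "b = (1 / sqrt (- form a a)) *\<^sub>R a"
  have b: "form b b = -1"
    using neg by (simp add: b_def form_simps field_simps)
  have b\<sigma>: "b \<in> ?\<sigma>" unfolding b_def using a\<sigma> sub by (rule subspace_scale[rotated])
  obtain R where R: "R \<in> O_pq" "R *v b = axis (Inr j) 1"
    "\<And>x. form x b = 0 \<Longrightarrow> form x (axis (Inr j) 1) = 0 \<Longrightarrow> R *v x = x"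
    using reflection_exists'[of b "axis (Inr j) 1"] b by (auto simp: form_axis_Inr)
  \<comment> \<open>The earlier axes are orthogonal both to \<open>b\<close> and to the new axis, so
    \<open>R\<close> fixes them.\<close>
  have fx: "R *v axis (Inr k) 1 = axis (Inr k) 1" if "k \<in> J" for k
  proof (rule R(3))
    show "form (axis (Inr k) 1) b = 0"
      using aJ[OF that] by (simp add: b_def form_simps form_commute form_axis_Inr)
    show "form (axis (Inr k) 1) (axis (Inr j) 1) = 0"
      using that insert(2) by (auto simp: form_axis_Inr axis_mult)
  qed
  have im: "(*v) (R ** A) ` \<tau> = (*v) R ` ?\<sigma>"
    by (auto simp: image_image simp flip: matrix_vector_mul_assoc)
  have "\<forall>k\<in>insert j J. axis (Inr k) 1 \<in> (*v) R ` ?\<sigma>"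
    using R(2) b\<sigma> fx A(2) by (metis imageI insertE)
  then show ?case using im O_pq_mult[OF R(1) A(1)] by metis
qed

lemma vec_decomp_Inr:
  fixes x :: "('p::finite, 'q::finite) vpq"
  shows "(\<Sum>k\<in>UNIV. x $ Inr k *\<^sub>R axis (Inr k) 1) $ i = (case i of Inl _ \<Rightarrow> 0 | Inr _ \<Rightarrow> x $ i)"
proof (cases i)
  case (Inl a)
  then show ?thesis by (simp add: axis_def)
next
  case (Inr b)
  have "(\<Sum>k\<in>UNIV. x $ Inr k *\<^sub>R axis (Inr k) 1 :: ('p, 'q) vpq) $ i
      = (\<Sum>k\<in>UNIV. if k = b then x $ Inr k else 0)"
    unfolding sum_component Inr by (rule sum.cong) (auto simp: axis_def)
  then show ?thesis using Inr by simp
qed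

lemma XG_transitive:
  fixes \<tau> :: "('p::finite, 'q::finite) vpq set"
  assumes "\<tau> \<in> XG"
  obtains A where "A \<in> O_pq" "\<tau> = (*v) A ` std_neg"
proof -
  obtain A where A: "A \<in> O_pq" "\<And>j. axis (Inr j) 1 \<in> (*v) A ` \<tau>"
    using axes_in_image[of UNIV \<tau>] assms by auto
  let ?\<sigma> = "(*v) A ` \<tau>"
  have \<sigma>: "?\<sigma> \<in> XG" using A(1) assms by (rule XG_image)
  then have sub: "subspace ?\<sigma>" by (simp add: XG_def)
  have S: "(\<Sum>k\<in>UNIV. x $ Inr k *\<^sub>R axis (Inr k) 1) \<in> ?\<sigma>" for x :: "('p, 'q) vpq"
    using A(2) sub by (intro subspace_sum subspace_scale) auto
  have "?\<sigma> = std_neg"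
  proof (intro equalityI subsetI)
    fix x :: "('p, 'q) vpq"
    let ?s = "(\<Sum>k\<in>UNIV. x $ Inr k *\<^sub>R axis (Inr k) 1)"
    show "x \<in> ?\<sigma>" if "x \<in> std_neg"
    proof -
      have "?s = x"
        unfolding vec_eq_iff vec_decomp_Inr using that by (auto simp: std_neg_def split: sum.splits)
      with S[of x] show ?thesis by (rule back_subst)
    qed
    \<comment> \<open>Subtracting the \<open>Inr\<close> part leaves a vector \<open>y\<close> of
      the image with \<open>form y y\<close> nonnegative; negative definiteness forces it to be
      0.\<close>
    show "x \<in> std_neg" if "x \<in> ?\<sigma>"
    proof -
      define y where "y = x - ?s"
      have "y \<in> ?\<sigma>" using that S sub by (simp add: y_def subspace_diff)
      moreover have y: "y $ i = x $ i - (case i of Inl _ \<Rightarrow> 0 | Inr _ \<Rightarrow> x $ i)" for i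
        unfolding y_def vector_minus_component vec_decomp_Inr by simp
      then have "form y y \<ge> 0"
        by (simp add: form_def sum_nonneg)
      moreover have "\<forall>y\<in>?\<sigma>. y \<noteq> 0 \<longrightarrow> form y y < 0"
        using \<sigma> unfolding XG_def by blast
      ultimately have "y = 0" by (meson not_le)
      then have "x $ Inl i = 0" for i using y[of "Inl i"] by simp
      then show ?thesis by (simp add: std_neg_def)
    qed
  qed
  moreover have "(*v) (adj A) ` ?\<sigma> = \<tau>"
    by (simp add: image_image O_pq_inv(3)[OF A(1)])
  ultimately show ?thesis using that O_pq_adj[OF A(1)] by metis
qed

text \<open>Existence of the projection is transported from \<open>std_neg\<close>, where the matrix
  is explicit.\<close>

lemma XG_is_proj:
  assumes "\<tau> \<in> XG"
  shows "is_proj \<tau> (proj \<tau>)"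
proof -
  obtain A where "A \<in> O_pq" "\<tau> = (*v) A ` std_neg" using assms by (rule XG_transitive)
  then have "is_proj \<tau> (A ** ((1/2) *\<^sub>R (mat 1 - sgn_mat)) ** adj A)"
    using is_proj_image is_proj_std_neg by blast
  then show ?thesis using proj_eq by metis
qed

lemma proj_image:
  assumes "A \<in> O_pq" "\<tau> \<in> XG"
  shows "proj ((*v) A ` \<tau>) = A ** proj \<tau> ** adj A"
  using is_proj_image[OF assms(1) XG_is_proj[OF assms(2)]] by (rule proj_eq)

lemma proj_form:
  assumes "is_proj \<tau> P"
  shows "form (P *v x) (P *v y) = form (P *v x) y" "form (P *v x) (P *v y) = form x (P *v y)"
proof -
  have "form (P *v x) (y - P *v y) = 0" "form (P *v y) (x - P *v x) = 0"
    using assms by (auto simp: is_proj_def perp_def)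
  then show "form (P *v x) (P *v y) = form (P *v x) y" "form (P *v x) (P *v y) = form x (P *v y)"
    by (auto simp: form_simps form_commute)
qed

section \<open>The inner product attached to a negative definite subspace\<close>

lemma ip_eq:
  assumes "\<tau> \<in> XG"
  shows "ip \<tau> x y = form x y - 2 * form (proj \<tau> *v x) y"
  using proj_form[OF XG_is_proj[OF assms], of x y]
  by (simp add: ip_def form_simps)

lemma ip_commute: "ip \<tau> x y = ip \<tau> y x"
  by (simp add: ip_def form_commute)

lemma ip_image:
  assumes "A \<in> O_pq" "\<tau> \<in> XG"
  shows "ip ((*v) A ` \<tau>) (A *v x) (A *v y) = ip \<tau> x y"
  using assms
  by (simp add: ip_eq XG_image proj_image O_pq_form O_pq_inv flip: matrix_vector_mul_assoc)

lemma ip_in: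
  assumes "\<tau> \<in> XG" "x \<in> \<tau>"
  shows "ip \<tau> x y = - form x y"
  using XG_is_proj[OF assms(1)] assms by (simp add: ip_eq is_proj_def)

text \<open>The dimension of \<open>std_neg\<close> is not computed: an isometry carries membership
  back from any given element of \<open>XG\<close>.\<close>

lemma std_neg_XG: "std_neg \<in> (XG :: ('p::finite, 'q::finite) vpq set set) \<longleftrightarrow> (XG :: ('p, 'q) vpq set set) \<noteq> {}"
proof
  assume "(XG :: ('p, 'q) vpq set set) \<noteq> {}"
  then obtain \<tau> :: "('p, 'q) vpq set" where \<tau>: "\<tau> \<in> XG" by blast
  then obtain A where A: "A \<in> O_pq" "\<tau> = (*v) A ` std_neg" by (rule XG_transitive)
  have "(*v) (adj A) ` \<tau> = std_neg" using A by (auto simp: image_image O_pq_inv)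
  then show "std_neg \<in> (XG :: ('p, 'q) vpq set set)" using XG_image[OF O_pq_adj[OF A(1)] \<tau>] by simp
qed auto

lemma ip_std_neg: "std_neg \<in> (XG :: ('p::finite, 'q::finite) vpq set set) \<Longrightarrow> ip (std_neg :: ('p, 'q) vpq set) x y = x \<bullet> y"
  by (simp add: ip_eq proj_eq[OF is_proj_std_neg] mv_simps form_simps)
     (simp add: form_inner inner_sgn_mat diff_divide_distrib)

text \<open>The columns of \<open>A\<close> are orthonormal for \<open>ip \<tau>\<close> and
  pseudo-orthonormal for \<open>form\<close> at once, so estimates at \<tau> reduce to Euclidean
  ones.\<close>

lemma XG_frame:
  fixes \<tau> :: "('p::finite, 'q::finite) vpq set"
  assumes "\<tau> \<in> XG"
  obtains A where "A \<in> O_pq" "\<And>x y. ip \<tau> (A *v x) (A *v y) = x \<bullet> y"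
proof -
  obtain A where A: "A \<in> O_pq" "\<tau> = (*v) A ` std_neg" using assms by (rule XG_transitive)
  have n: "std_neg \<in> (XG :: ('p, 'q) vpq set set)" using assms std_neg_XG by blast
  show ?thesis using that[OF A(1)] A ip_image[OF A(1) n] ip_std_neg[OF n] by simp
qed

lemma ip_pos:
  assumes "\<tau> \<in> XG" "x \<noteq> 0"
  shows "ip \<tau> x x > 0"
proof -
  obtain A where A: "A \<in> O_pq" "\<And>x y. ip \<tau> (A *v x) (A *v y) = x \<bullet> y"
    using XG_frame[OF assms(1)] by blast
  have "ip \<tau> x x = (adj A *v x) \<bullet> (adj A *v x)"
    using A(2)[of "adj A *v x" "adj A *v x"] by (simp add: O_pq_inv[OF A(1)])
  moreover have "adj A *v x \<noteq> 0" using assms(2) O_pq_inv(4)[OF A(1), of x] by auto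
  ultimately show ?thesis by simp
qed

section \<open>The norm on the Lie algebra and a Cauchy-Schwarz estimate\<close>

lemma so_pq_conj: "A \<in> O_pq \<Longrightarrow> X \<in> so_pq \<Longrightarrow> A ** X ** adj A \<in> so_pq"
  by (simp add: so_pq_iff adj_mult matrix_mul_assoc mm.minus_left mm.minus_right)

lemma pp_image:
  assumes "A \<in> O_pq" "\<tau> \<in> XG" "X \<in> pp \<tau>"
  shows "A ** X ** adj A \<in> pp ((*v) A ` \<tau>)"
proof -
  have "ip ((*v) A ` \<tau>) (A ** X ** adj A *v x) y = ip ((*v) A ` \<tau>) x (A ** X ** adj A *v y)" for x y
  proof -
    have "ip ((*v) A ` \<tau>) (A *v (X *v (adj A *v x))) (A *v (adj A *v y))
        = ip ((*v) A ` \<tau>) (A *v (adj A *v x)) (A *v (X *v (adj A *v y)))"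
      unfolding ip_image[OF assms(1,2)] using assms(3) by (simp add: pp_def)
    then show ?thesis by (simp add: O_pq_inv[OF assms(1)] flip: matrix_vector_mul_assoc)
  qed
  then show ?thesis using assms by (auto simp: pp_def so_pq_conj)
qed

lemma trace_conj:
  assumes "A \<in> O_pq"
  shows "trace ((A ** X ** adj A) ** (A ** X ** adj A)) = trace (X ** X)"
proof -
  have "(A ** X ** adj A) ** (A ** X ** adj A) = A ** (X ** (adj A ** A) ** X ** adj A)"
    by (simp add: matrix_mul_assoc)
  also have "\<dots> = A ** (X ** X ** adj A)" by (simp add: O_pq_inv[OF assms])
  finally have "trace ((A ** X ** adj A) ** (A ** X ** adj A)) = trace ((X ** X ** adj A) ** A)"
    by (simp only: trace_mul_sym[of A])
  then show ?thesis by (simp add: O_pq_inv[OF assms] flip: matrix_mul_assoc)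
qed

lemma nrm_eq:
  fixes X :: "('p::finite, 'q::finite) mpq"
  assumes "CARD('p) + CARD('q) > 2"
  shows "nrm X = trace (X ** X) / 2"
proof -
  have "real (CARD('p) + CARD('q)) - 2 \<noteq> 0" using assms by linarith
  then show ?thesis by (simp add: nrm_def killing_def field_simps)
qed

lemma nrm_conj:
  assumes "A \<in> O_pq"
  shows "nrm (A ** X ** adj A) = nrm X"
  by (simp add: nrm_def killing_def trace_conj[OF assms])

lemma inner_outer: "Y \<bullet> outer a b = a \<bullet> (Y *v b)" for Y :: "real ^ 'n ^ 'm"
proof -
  have "outer a b $ i = a $ i *\<^sub>R b" for i by (simp add: outer_def vec_eq_iff)
  moreover have "(Y *v b) $ i = Y $ i \<bullet> b" for i
    by (simp add: matrix_vector_mult_def inner_vec_def)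
  ultimately show ?thesis by (simp add: inner_vec_def[of Y] inner_vec_def[of a])
qed

text \<open>Cauchy-Schwarz in the space of matrices for \<open>Y\<close> and \<open>m m\<^sup>T - (sgn_mat m) (sgn_mat m)\<^sup>T\<close>.\<close>

lemma inner_bound:
  fixes Y :: "('p::finite, 'q::finite) mpq"
  assumes "transpose Y = Y" "Y ** sgn_mat = - sgn_mat ** Y"
  shows "\<bar>m \<bullet> (Y *v m)\<bar> \<le> sqrt (trace (Y ** Y) / 2) * (m \<bullet> m)"
proof -
  define M where "M = outer m m - outer (sgn_mat *v m) (sgn_mat *v m)"
  have "Y *v (sgn_mat *v m) = - (sgn_mat *v (Y *v m))"
    using assms(2) by (simp add: matrix_vector_mul_assoc mv.minus_left[symmetric] mm.minus_left)
  then have YM: "Y \<bullet> M = 2 * (m \<bullet> (Y *v m))"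
    by (simp add: M_def inner_diff_right inner_outer inner_sgn_mat)
  \<comment> \<open>Pairing with \<open>M\<close> instead of \<open>outer m m\<close> gives the
    constant needed: the product with \<open>Y\<close> doubles, while the bound on the norm grows
    only by \<open>sqrt 2\<close>.\<close>
  have "M \<bullet> M = 2 * (m \<bullet> m)\<^sup>2 - 2 * (m \<bullet> (sgn_mat *v m))\<^sup>2"
    by (simp add: M_def inner_diff_right inner_diff_left inner_outer outer_mult_vec inner_sgn_mat
      power2_eq_square inner_commute)
  then have "norm M \<le> sqrt 2 * (m \<bullet> m)"
    unfolding norm_eq_sqrt_inner
    by (intro real_le_lsqrt) (auto simp: power_mult_distrib)
  moreover have "\<bar>2 * (m \<bullet> (Y *v m))\<bar> \<le> norm Y * norm M"
    using Cauchy_Schwarz_ineq2[of Y M] by (simp add: YM)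
  ultimately have "2 * \<bar>m \<bullet> (Y *v m)\<bar> \<le> norm Y * (sqrt 2 * (m \<bullet> m))"
    using mult_left_mono[of "norm M" "sqrt 2 * (m \<bullet> m)" "norm Y"] by (simp add: abs_mult)
  moreover have "norm Y = sqrt (trace (Y ** Y))"
  proof -
    have "transpose Y $ i $ j = Y $ j $ i" for i j by (simp add: transpose_def)
    then have "Y $ i $ j * Y $ j $ i = Y $ i $ j * Y $ i $ j" for i j
      by (simp only: assms(1))
    then have "trace (Y ** Y) = Y \<bullet> Y"
      unfolding trace_def matrix_matrix_mult_def inner_vec_def vec_lambda_beta inner_real_def
      by (intro sum.cong refl)
    then show ?thesis by (simp add: norm_eq_sqrt_inner)
  qed
  moreover have "sqrt (trace (Y ** Y) / 2) * 2 = sqrt (trace (Y ** Y)) * sqrt 2"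
    by (simp add: real_sqrt_divide field_simps)
  ultimately have "2 * \<bar>m \<bullet> (Y *v m)\<bar> \<le> 2 * (sqrt (trace (Y ** Y) / 2) * (m \<bullet> m))"
    by (simp add: algebra_simps)
  then show ?thesis by simp
qed

text \<open>This is the infinitesimal form of the statement that half the logarithm of
  \<open>ip \<tau> n n\<close> is 1-Lipschitz in \<tau>. In a frame, \<open>X\<close> becomes a
  symmetric matrix anticommuting with \<open>sgn_mat\<close>, and \<open>inner_bound\<close>
  applies.\<close>

lemma ip_bound:
  fixes X :: "('p::finite, 'q::finite) mpq"
  assumes "CARD('p) + CARD('q) > 2" "\<tau> \<in> XG" "X \<in> pp \<tau>"
  shows "\<bar>ip \<tau> n (X *v n)\<bar> \<le> sqrt (nrm X) * ip \<tau> n n"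
proof -
  obtain A where A: "A \<in> O_pq" "\<And>x y. ip \<tau> (A *v x) (A *v y) = x \<bullet> y"
    using XG_frame[OF assms(2)] by blast
  note inv = O_pq_inv[OF A(1)]
  define Y where "Y = adj A ** X ** A"
  define m where "m = adj A *v n"
  have n: "n = A *v m" by (simp add: m_def inv)
  have X: "X *v (A *v z) = A *v (Y *v z)" for z
    by (simp add: Y_def inv flip: matrix_vector_mul_assoc)
  have "(Y *v x) \<bullet> y = x \<bullet> (Y *v y)" for x y
  proof -
    have "ip \<tau> (X *v (A *v x)) (A *v y) = ip \<tau> (A *v x) (X *v (A *v y))"
      using assms(3) by (simp add: pp_def)
    then show ?thesis by (simp add: A(2) X)
  qed
  then have T: "transpose Y = Y"
    by (intro matrix_eqI) (metis inner_transpose vector_eq_ldot)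
  have "X \<in> so_pq" using assms(3) by (simp add: pp_def)
  then have "Y \<in> so_pq"
    using so_pq_conj[OF O_pq_adj[OF A(1)], of X] by (simp add: Y_def)
  then have "sgn_mat ** Y ** sgn_mat = - Y" using T by (simp add: so_pq_iff adj_def)
  then have "sgn_mat ** (sgn_mat ** Y ** sgn_mat) = - sgn_mat ** Y" by (simp add: mm.minus_left mm.minus_right)
  then have "Y ** sgn_mat = - sgn_mat ** Y" by (simp add: matrix_mul_assoc)
  with T have "\<bar>m \<bullet> (Y *v m)\<bar> \<le> sqrt (trace (Y ** Y) / 2) * (m \<bullet> m)"
    by (rule inner_bound)
  moreover have "trace (Y ** Y) = trace (X ** X)"
    using trace_conj[OF O_pq_adj[OF A(1)], of X] by (simp add: Y_def)
  ultimately show ?thesis by (simp add: n X A(2) nrm_eq[OF assms(1)])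
qed

subsection \<open>The matrix exponential\<close>

lemma matrix_power_scaleR:
  "((**) (s *\<^sub>R X) ^^ k) (mat 1) = s ^ k *\<^sub>R ((**) X ^^ k) (mat 1)" for X :: "real ^ 'n ^ 'n"
  by (induction k) (simp_all add: mm.scaleR_left mm.scaleR_right mult.commute)

text \<open>Comparison with the real exponential series at \<open>norm X * K\<close>, where
  \<open>K\<close> bounds the bilinear matrix product.\<close>

lemma mexp_sums: "(\<lambda>k. (1 / fact k) *\<^sub>R ((**) X ^^ k) (mat 1)) sums mexp X"
  for X :: "real ^ 'n ^ 'n"
proof -
  obtain K where K: "K > 0" "\<And>(A :: real ^ 'n ^ 'n) (B :: real ^ 'n ^ 'n). norm (A ** B) \<le> norm A * norm B * K"
    using mm.pos_bounded by blast
  have le: "norm (((**) X ^^ k) (mat 1)) \<le> (norm X * K) ^ k * norm (mat 1 :: real ^ 'n ^ 'n)" for k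
  proof (induction k)
    case (Suc k)
    have "norm (X ** ((**) X ^^ k) (mat 1)) \<le> (norm X * K) * norm (((**) X ^^ k) (mat 1))"
      using K(2)[of X "((**) X ^^ k) (mat 1)"] by (simp add: mult_ac)
    also have "\<dots> \<le> (norm X * K) * ((norm X * K) ^ k * norm (mat 1 :: real ^ 'n ^ 'n))"
      using Suc K(1) by (intro mult_left_mono) auto
    finally show ?case by (simp add: mult_ac)
  qed simp
  have "summable (\<lambda>k. (1 / fact k) *\<^sub>R ((**) X ^^ k) (mat 1))"
  proof (rule summable_comparison_test)
    show "\<exists>N. \<forall>k\<ge>N. norm ((1 / fact k) *\<^sub>R ((**) X ^^ k) (mat 1))
        \<le> inverse (fact k) * (norm X * K) ^ k * norm (mat 1 :: real ^ 'n ^ 'n)"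
      using le by (auto intro!: exI[of _ 0] mult_left_mono simp: divide_inverse mult.assoc)
    show "summable (\<lambda>k. inverse (fact k) * (norm X * K) ^ k * norm (mat 1 :: real ^ 'n ^ 'n))"
      by (intro summable_mult2 summable_exp)
  qed
  then show ?thesis by (simp add: mexp_def summable_sums)
qed

text \<open>On an eigenvector the matrix series becomes the real exponential series. This replaces
  any closed form of the exponential of a transvection.\<close>

lemma mexp_eigenvector:
  fixes Y :: "real ^ 'n ^ 'n"
  assumes "Y *v v = l *\<^sub>R v"
  shows "mexp Y *v v = exp l *\<^sub>R v"
proof -
  have "((**) Y ^^ k) (mat 1) *v v = l ^ k *\<^sub>R v" for k
    by (induction k) (simp_all add: assms mv.scaleR_right mult.commute flip: matrix_vector_mul_assoc)
  then have "((1 / fact k) *\<^sub>R ((**) Y ^^ k) (mat 1)) *v v = (l ^ k /\<^sub>R fact k) *\<^sub>R v" for k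
    by (simp add: mv.scaleR_left divide_inverse mult.commute)
  then have "(\<lambda>k. (l ^ k /\<^sub>R fact k) *\<^sub>R v) sums (mexp Y *v v)"
    using bounded_linear.sums[OF mv.bounded_linear_left mexp_sums[of Y], of v] by simp
  moreover have "(\<lambda>k. (l ^ k /\<^sub>R fact k) *\<^sub>R v) sums (exp l *\<^sub>R v)"
    by (rule bounded_linear.sums[OF bounded_linear_scaleR_left exp_converges])
  ultimately show ?thesis by (rule sums_unique2)
qed

lemma mexp_0 [simp]: "mexp 0 = mat 1"
  by (rule matrix_eqI, subst mexp_eigenvector[where l = 0]) simp_all

lemma mexp_commute: "Y ** mexp Y = mexp Y ** Y" for Y :: "real ^ 'n ^ 'n"
proof -
  have "((**) Y ^^ k) (mat 1) ** Y = Y ** ((**) Y ^^ k) (mat 1)" for k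
    by (induction k) (simp_all flip: matrix_mul_assoc)
  then have "((1 / fact k) *\<^sub>R ((**) Y ^^ k) (mat 1)) ** Y = Y ** ((1 / fact k) *\<^sub>R ((**) Y ^^ k) (mat 1))" for k
    by (simp add: mm.scaleR_left mm.scaleR_right)
  then show ?thesis
    using bounded_linear.sums[OF mm.bounded_linear_left mexp_sums[of Y], of Y]
      bounded_linear.sums[OF mm.bounded_linear_right mexp_sums[of Y], of Y]
    by (simp add: sums_unique2)
qed

lemma has_vector_derivative_vec:
  fixes f :: "real \<Rightarrow> 'a::euclidean_space ^ 'n"
  assumes "\<And>i. ((\<lambda>t. f t $ i) has_vector_derivative f' $ i) (at x within S)"
  shows "(f has_vector_derivative f') (at x within S)"
  unfolding has_vector_derivative_def
proof (subst has_derivative_componentwise_within, safe)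
  fix b :: "'a ^ 'n" assume "b \<in> Basis"
  then obtain i u where b: "b = axis i u" by (auto simp: Basis_vec_def)
  have "((\<lambda>t. f t $ i \<bullet> u) has_vector_derivative f' $ i \<bullet> u) (at x within S)"
    by (rule bounded_linear.has_vector_derivative[OF bounded_linear_inner_left assms])
  then show "((\<lambda>x. f x \<bullet> b) has_derivative (\<lambda>x. (x *\<^sub>R f') \<bullet> b)) (at x within S)"
    by (simp add: b inner_axis has_vector_derivative_def)
qed

text \<open>Each entry is an everywhere convergent power series in \<open>s\<close>. The index shift
  in \<open>diffs\<close> accounts for the extra factor \<open>X\<close>.\<close>

lemma mexp_scaleR_has_vector_derivative:
  fixes X :: "real ^ 'n ^ 'n"
  shows "((\<lambda>s. mexp (s *\<^sub>R X)) has_vector_derivative X ** mexp (t *\<^sub>R X)) (at t within S)"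
proof (intro has_vector_derivative_vec)
  fix i j
  define c where "c k = ((**) X ^^ k) (mat 1) $ i $ j / fact k" for k
  have sums: "(\<lambda>k. c k * s ^ k) sums (mexp (s *\<^sub>R X) $ i $ j)" for s
  proof -
    have "(\<lambda>k. ((1 / fact k) *\<^sub>R ((**) (s *\<^sub>R X) ^^ k) (mat 1)) $ i $ j) sums (mexp (s *\<^sub>R X) $ i $ j)"
      by (intro sums_vec_nth mexp_sums)
    then show ?thesis by (simp add: matrix_power_scaleR c_def mult_ac)
  qed
  then have "summable (\<lambda>k. c k * s ^ k)" for s using sums_summable by blast
  then have "((\<lambda>s. \<Sum>k. c k * s ^ k) has_field_derivative (\<Sum>k. diffs c k * t ^ k)) (at t)"
    by (rule termdiffs_strong_converges_everywhere)
  moreover have "(\<lambda>s. \<Sum>k. c k * s ^ k) = (\<lambda>s. mexp (s *\<^sub>R X) $ i $ j)"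
    using sums sums_unique by (metis (no_types, lifting))
  moreover have "(\<Sum>k. diffs c k * t ^ k) = (X ** mexp (t *\<^sub>R X)) $ i $ j"
  proof -
    have "(\<lambda>k. (X ** ((1 / fact k) *\<^sub>R ((**) (t *\<^sub>R X) ^^ k) (mat 1))) $ i $ j)
        sums ((X ** mexp (t *\<^sub>R X)) $ i $ j)"
      by (intro sums_vec_nth bounded_linear.sums[OF mm.bounded_linear_right mexp_sums])
    moreover have "(X ** ((1 / fact k) *\<^sub>R ((**) (t *\<^sub>R X) ^^ k) (mat 1))) $ i $ j
        = diffs c k * t ^ k" for k
    proof -
      have "real (Suc k) / fact (Suc k) = 1 / fact k"
        by (simp add: fact_Suc del: of_nat_Suc)
      then have "diffs c k = (X ** ((**) X ^^ k) (mat 1)) $ i $ j / fact k"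
        by (simp add: diffs_def c_def del: of_nat_Suc fact_Suc)
           (metis (no_types) mult.commute times_divide_eq_right mult.right_neutral times_divide_eq_left)
      then show ?thesis by (simp add: matrix_power_scaleR mm.scaleR_right)
    qed
    ultimately show ?thesis by (simp add: sums_iff)
  qed
  ultimately show "((\<lambda>s. mexp (s *\<^sub>R X) $ i $ j) has_vector_derivative (X ** mexp (t *\<^sub>R X)) $ i $ j)
      (at t within S)"
    by (simp add: has_real_derivative_iff_has_vector_derivative has_vector_derivative_at_within)
qed

text \<open>Along \<open>mexp (s *\<^sub>R X)\<close> the form of two moved vectors has derivative 0
  because \<open>X\<close> is skew, so its values at 0 and 1 agree.\<close>

lemma mexp_O_pq:
  assumes "X \<in> so_pq"
  shows "mexp X \<in> O_pq"
proof -
  have "form (mexp X *v x) (mexp X *v y) = form x y" for x y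
  proof -
    let ?f = "\<lambda>s. form (mexp (s *\<^sub>R X) *v x) (mexp (s *\<^sub>R X) *v y)"
    have "(?f has_real_derivative 0) (at t)" for t
    proof -
      let ?E = "mexp (t *\<^sub>R X)"
      have v: "((\<lambda>s. mexp (s *\<^sub>R X) *v z) has_vector_derivative (X ** ?E) *v z) (at t)" for z
        by (rule bounded_linear.has_vector_derivative[OF mv.bounded_linear_left
              mexp_scaleR_has_vector_derivative])
      have "(?f has_vector_derivative
          form (?E *v x) ((X ** ?E) *v y) + form ((X ** ?E) *v x) (?E *v y)) (at t)"
        by (rule form.has_vector_derivative[OF v v])
      moreover have "form (?E *v x) ((X ** ?E) *v y) + form ((X ** ?E) *v x) (?E *v y) = 0"
        using so_pq_skew[OF assms, of "?E *v x" "?E *v y"] by (simp flip: matrix_vector_mul_assoc)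
      ultimately show ?thesis by (simp add: has_real_derivative_iff_has_vector_derivative)
    qed
    then have "?f 1 = ?f 0" by (intro DERIV_isconst_all) auto
    then show ?thesis by simp
  qed
  then show ?thesis by (simp add: O_pq_def)
qed

lemma so_pq_scaleR: "X \<in> so_pq \<Longrightarrow> s *\<^sub>R X \<in> so_pq"
  by (simp add: so_pq_def mv.scaleR_left form.scaleR_left form.scaleR_right flip: distrib_left)

text \<open>The determinant along the one-parameter group is continuous, starts at 1 and takes only
  the values 1 and -1; reaching -1 would force a zero.\<close>

lemma det_mexp:
  assumes "X \<in> so_pq"
  shows "det (mexp X) = 1"
proof (rule ccontr)
  let ?f = "\<lambda>s. det (mexp (s *\<^sub>R X))"
  have d: "?f s = 1 \<or> ?f s = -1" for s
    by (intro det_O_pq mexp_O_pq so_pq_scaleR assms)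
  assume "det (mexp X) \<noteq> 1"
  then have "?f 1 \<le> 0" using d[of 1] by simp
  moreover have "0 \<le> ?f 0" by simp
  moreover have "continuous_on {0..1} ?f"
  proof -
    have "continuous_on {0..1} (\<lambda>s. mexp (s *\<^sub>R X))"
      by (intro continuous_at_imp_continuous_on ballI has_vector_derivative_continuous)
         (rule mexp_scaleR_has_vector_derivative)
    then show ?thesis unfolding det_def by (intro continuous_intros)
  qed
  ultimately obtain s where "?f s = 0" using IVT2'[of ?f 1 0 0] by auto
  then show False using d[of s] by simp
qed

lemma mexp_SO_pq: "X \<in> so_pq \<Longrightarrow> mexp X \<in> SO_pq"
  by (simp add: SO_pq_iff mexp_O_pq det_mexp)

subsection \<open>The action on subspaces and the tangent vectors\<close>

lemma psl_act_class:
  fixes A :: "real ^ 'n ^ 'n"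
  assumes "det A = 1" "subspace W"
  shows "psl_act (psl_class A) W = (*v) A ` W"
proof (intro equalityI subsetI)
  fix y assume "y \<in> psl_act (psl_class A) W"
  then obtain c w where "w \<in> W" "y = (c *\<^sub>R A) *v w"
    by (auto simp: psl_act_def psl_class_def)
  then have "c *\<^sub>R w \<in> W" "y = A *v (c *\<^sub>R w)"
    using assms(2) by (auto simp: mv.scaleR_left mv.scaleR_right subspace_scale)
  then show "y \<in> (*v) A ` W" by blast
next
  fix y assume y: "y \<in> (*v) A ` W"
  have "A \<in> psl_class A" using assms(1) by (auto simp: psl_class_def intro: exI[of _ 1])
  with y show "y \<in> psl_act (psl_class A) W" by (auto simp: psl_act_def)
qed

text \<open>Moved projections are conjugates of \<open>proj \<sigma>\<close>; the product rule,
  together with \<open>adj X = - X\<close>, gives a commutator.\<close>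

lemma proj_mexp_has_vector_derivative:
  assumes "\<sigma> \<in> XG" "X \<in> so_pq"
  defines "Q \<equiv> \<lambda>s. proj ((*v) (mexp (s *\<^sub>R X)) ` \<sigma>)"
  shows "(Q has_vector_derivative (X ** Q t - Q t ** X)) (at t within S)"
proof -
  let ?E = "\<lambda>s. mexp (s *\<^sub>R X)"
  have O: "?E s \<in> O_pq" for s by (intro mexp_O_pq so_pq_scaleR assms)
  have Q: "Q = (\<lambda>s. ?E s ** proj \<sigma> ** adj (?E s))"
    unfolding Q_def using proj_image[OF O assms(1)] by blast
  have 1: "(?E has_vector_derivative X ** ?E t) (at t within S)"
    by (rule mexp_scaleR_has_vector_derivative)
  have 2: "((\<lambda>s. ?E s ** proj \<sigma>) has_vector_derivative X ** ?E t ** proj \<sigma>) (at t within S)"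
    by (rule bounded_linear.has_vector_derivative[OF mm.bounded_linear_left 1])
  have 3: "((\<lambda>s. adj (?E s)) has_vector_derivative adj (X ** ?E t)) (at t within S)"
    by (rule bounded_linear.has_vector_derivative[OF bounded_linear_adj 1])
  have "adj (X ** ?E t) = - (adj (?E t) ** X)"
    using assms(2) by (simp add: adj_mult so_pq_iff mm.minus_right)
  then have "?E t ** proj \<sigma> ** adj (X ** ?E t) + X ** ?E t ** proj \<sigma> ** adj (?E t)
      = X ** Q t - Q t ** X"
    by (simp add: Q mm.minus_right matrix_mul_assoc)
  then show ?thesis
    using mm.has_vector_derivative[OF 2 3] by (simp add: Q)
qed

lemma XG_subspace: "\<tau> \<in> XG \<Longrightarrow> subspace \<tau>"
  by (simp add: XG_def)

lemma tangent_eq: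
  assumes "\<tau> \<in> XG" "X \<in> so_pq"
  shows "tangent \<tau> X = X ** proj \<tau> - proj \<tau> ** X"
proof -
  have "psl_act (pexp (s *\<^sub>R X)) \<tau> = (*v) (mexp (s *\<^sub>R X)) ` \<tau>" for s
    unfolding pexp_def
    by (intro psl_act_class det_mexp so_pq_scaleR assms XG_subspace)
  moreover have "((\<lambda>s. proj ((*v) (mexp (s *\<^sub>R X)) ` \<tau>)) has_vector_derivative
      X ** proj \<tau> - proj \<tau> ** X) (at 0)"
    using proj_mexp_has_vector_derivative[OF assms, of 0 UNIV] by simp
  ultimately show ?thesis by (simp add: tangent_def vector_derivative_at)
qed

text \<open>The curve \<open>mexp (s *\<^sub>R Y)\<close> applied to \<sigma> has constant velocity
  \<open>Y\<close>, so its length is \<open>sqrt (nrm Y)\<close>.\<close>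

lemma dXG_mexp_le:
  assumes "\<sigma> \<in> XG" "Y \<in> pp \<sigma>"
  shows "dXG \<sigma> ((*v) (mexp Y) ` \<sigma>) \<le> ereal (sqrt (nrm Y))"
proof -
  let ?T = "\<lambda>s. (*v) (mexp (s *\<^sub>R Y)) ` \<sigma>"
  have Y: "Y \<in> so_pq" using assms(2) by (simp add: pp_def)
  have O: "mexp (t *\<^sub>R Y) \<in> O_pq" for t by (intro mexp_O_pq so_pq_scaleR Y)
  have T: "?T t \<in> XG" for t by (rule XG_image[OF O assms(1)])
  \<comment> \<open>\<open>Y\<close> commutes with its exponentials, so conjugation by them fixes it
    and it stays admissible along the curve. The case of \<open>t = 0\<close> is separate because
    \<open>t\<close> is cancelled from the commutation relation.\<close>
  have "Y \<in> pp (?T t)" for t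
  proof (cases "t = 0")
    case False
    have "t *\<^sub>R (Y ** mexp (t *\<^sub>R Y)) = t *\<^sub>R (mexp (t *\<^sub>R Y) ** Y)"
      using mexp_commute[of "t *\<^sub>R Y"] by (simp add: mm.scaleR_left mm.scaleR_right)
    then have c: "mexp (t *\<^sub>R Y) ** Y = Y ** mexp (t *\<^sub>R Y)" using False by simp
    have "mexp (t *\<^sub>R Y) ** Y ** adj (mexp (t *\<^sub>R Y)) = Y"
      unfolding c by (simp add: O_pq_inv[OF O] flip: matrix_mul_assoc)
    then show ?thesis using pp_image[OF O assms, of t] by simp
  qed (use assms(2) in simp)
  then have "XG_curve ?T (\<lambda>_. Y)"
    unfolding XG_curve_def
    using T proj_mexp_has_vector_derivative[OF assms(1) Y] by (simp add: tangent_eq Y)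
  then show ?thesis
    unfolding dXG_def by (intro Inf_lower CollectI exI[of _ ?T] exI[of _ "\<lambda>_. Y"]) simp
qed

subsection \<open>The lower bound for the distance\<close>

text \<open>Since \<open>ip\<close> is affine in \<open>proj\<close>, its derivative along the curve
  comes from the commutator formula for tangent vectors; \<open>ip_bound\<close> then controls the
  logarithmic derivative.\<close>

lemma ln_ip_derivative:
  fixes T :: "real \<Rightarrow> ('p::finite, 'q::finite) vpq set"
  assumes "CARD('p) + CARD('q) > 2" "XG_curve T X" "t \<in> {0..1}" "n \<noteq> 0"
  obtains D where "((\<lambda>s. ln (ip (T s) n n)) has_real_derivative D) (at t within {0..1})"
    "\<bar>D\<bar> \<le> 2 * sqrt (nrm (X t))"
proof -
  have T: "T s \<in> XG" if "s \<in> {0..1}" for s using assms(2) that by (simp add: XG_curve_def)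
  have X: "X t \<in> pp (T t)" using assms(2,3) by (simp add: XG_curve_def)
  then have so: "X t \<in> so_pq" by (simp add: pp_def)
  let ?P = "proj (T t)"
  have "((\<lambda>s. proj (T s)) has_vector_derivative X t ** ?P - ?P ** X t) (at t within {0..1})"
    using assms(2,3) unfolding XG_curve_def tangent_eq[OF T[OF assms(3)] so, symmetric] by blast
  from bounded_linear.has_vector_derivative[OF mv.bounded_linear_left this, of n]
  have "((\<lambda>s. proj (T s) *v n) has_vector_derivative (X t ** ?P - ?P ** X t) *v n) (at t within {0..1})" .
  from bounded_linear.has_vector_derivative[OF form.bounded_linear_left this, of n]
  have "((\<lambda>s. form (proj (T s) *v n) n) has_vector_derivative form ((X t ** ?P - ?P ** X t) *v n) n)
      (at t within {0..1})" .
  \<comment> \<open>Skewness of \<open>X t\<close> and self-adjointness of the projection turn both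
    terms into \<open>- form (X t *v n) (?P *v n)\<close>. The missing term
    \<open>form n (X t *v n)\<close> of \<open>ip\<close> is 0.\<close>
  moreover have "form ((X t ** ?P - ?P ** X t) *v n) n = ip (T t) n (X t *v n)"
  proof -
    have "form (?P *v (X t *v n)) n = form (X t *v n) (?P *v n)"
      using proj_form[OF XG_is_proj[OF T[OF assms(3)]]] by metis
    moreover have "form n (X t *v n) = 0" using so_pq_skew_self[OF so] by (simp add: form_commute)
    ultimately show ?thesis
      using so_pq_skew[OF so, of "?P *v n" n]
      by (simp add: ip_eq[OF T[OF assms(3)]] mv.diff_left form_simps form_commute
          flip: matrix_vector_mul_assoc)
  qed
  ultimately have "((\<lambda>s. form (proj (T s) *v n) n) has_real_derivative ip (T t) n (X t *v n))
      (at t within {0..1})"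
    by (simp add: has_real_derivative_iff_has_vector_derivative)
  then have "((\<lambda>s. form n n - 2 * form (proj (T s) *v n) n) has_real_derivative
      - 2 * ip (T t) n (X t *v n)) (at t within {0..1})"
    by (auto intro!: derivative_eq_intros)
  then have "((\<lambda>s. ip (T s) n n) has_real_derivative - 2 * ip (T t) n (X t *v n)) (at t within {0..1})"
    unfolding has_real_derivative_iff_has_vector_derivative
    by (rule has_vector_derivative_transform[OF assms(3), rotated]) (simp add: ip_eq T)
  moreover have pos: "ip (T t) n n > 0" by (rule ip_pos[OF T[OF assms(3)] assms(4)])
  ultimately have D: "((\<lambda>s. ln (ip (T s) n n)) has_real_derivative
      - 2 * ip (T t) n (X t *v n) / ip (T t) n n) (at t within {0..1})"
    by (auto intro!: derivative_eq_intros)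
  have "\<bar>ip (T t) n (X t *v n)\<bar> / ip (T t) n n \<le> sqrt (nrm (X t))"
    using ip_bound[OF assms(1) T[OF assms(3)] X] pos by (simp add: divide_le_eq)
  then have "\<bar>- 2 * ip (T t) n (X t *v n) / ip (T t) n n\<bar> \<le> 2 * sqrt (nrm (X t))"
    using pos by (simp add: abs_mult)
  with D show ?thesis using that by blast
qed

lemma dXG_ge:
  fixes \<sigma> \<rho> :: "('p::finite, 'q::finite) vpq set"
  assumes "CARD('p) + CARD('q) > 2" "m \<noteq> 0" "n \<noteq> 0"
    and "ln (ip \<rho> m m) - ln (ip \<rho> n n) - (ln (ip \<sigma> m m) - ln (ip \<sigma> n n)) = 4 * s"
  shows "dXG \<sigma> \<rho> \<ge> ereal s"
  unfolding dXG_def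
proof (rule Inf_greatest, clarify)
  fix T X
  assume T: "XG_curve T X" "\<sigma> = T 0" "\<rho> = T 1"
  \<comment> \<open>Each logarithm changes at most at twice the speed of the curve, so a quarter of
    their difference changes at most at the speed.\<close>
  let ?f = "\<lambda>t. (ln (ip (T t) m m) - ln (ip (T t) n n)) / 4"
  have "\<forall>t\<in>{0..1}. \<exists>D. (?f has_real_derivative D) (at t within {0..1}) \<and> \<bar>D\<bar> \<le> sqrt (nrm (X t))"
  proof
    fix t :: real assume t: "t \<in> {0..1}"
    obtain D1 where D1: "((\<lambda>s. ln (ip (T s) m m)) has_real_derivative D1) (at t within {0..1})"
        "\<bar>D1\<bar> \<le> 2 * sqrt (nrm (X t))"
      using ln_ip_derivative[OF assms(1) T(1) t assms(2)] .
    obtain D2 where D2: "((\<lambda>s. ln (ip (T s) n n)) has_real_derivative D2) (at t within {0..1})"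
        "\<bar>D2\<bar> \<le> 2 * sqrt (nrm (X t))"
      using ln_ip_derivative[OF assms(1) T(1) t assms(3)] .
    from D1(1) D2(1) have "(?f has_real_derivative (D1 - D2) / 4) (at t within {0..1})"
      by (intro DERIV_cdivide DERIV_diff)
    moreover have "\<bar>D1 - D2\<bar> \<le> 2 * sqrt (nrm (X t)) + 2 * sqrt (nrm (X t))"
      by (rule order_trans[OF abs_triangle_ineq4 add_mono[OF D1(2) D2(2)]])
    then have "\<bar>(D1 - D2) / 4\<bar> \<le> sqrt (nrm (X t))" by simp
    ultimately show "\<exists>D. (?f has_real_derivative D) (at t within {0..1}) \<and> \<bar>D\<bar> \<le> sqrt (nrm (X t))"
      by blast
  qed
  from bchoice[OF this] obtain D
    where "\<forall>t\<in>{0..1}. (?f has_real_derivative D t) (at t within {0..1}) \<and> \<bar>D t\<bar> \<le> sqrt (nrm (X t))" ..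
  then have D: "\<And>t. t \<in> {0..1} \<Longrightarrow> (?f has_real_derivative D t) (at t within {0..1})"
      "\<And>t. t \<in> {0..1} \<Longrightarrow> \<bar>D t\<bar> \<le> sqrt (nrm (X t))"
    by blast+
  \<comment> \<open>\<open>D\<close> was chosen pointwise; being a derivative, it is gauge
    integrable without any continuity.\<close>
  have "(D has_integral ?f 1 - ?f 0) {0..1}"
    using D(1) by (intro fundamental_theorem_of_calculus)
      (auto simp: has_real_derivative_iff_has_vector_derivative)
  moreover have "?f 1 - ?f 0 = s" using assms(4) T(2,3) by (simp add: diff_divide_distrib)
  ultimately have "(D has_integral s) {0..1}" by simp
  \<comment> \<open>Integrability of the speed matters: \<open>integral\<close> would otherwise be
    the default value 0.\<close>
  moreover have "(\<lambda>t. sqrt (nrm (X t))) integrable_on {0..1}"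
  proof -
    have X: "continuous_on {0..1} X" using T(1) by (simp add: XG_curve_def)
    have "continuous_on {0..1} (\<lambda>t. sqrt (nrm (X t)))"
      unfolding nrm_def killing_def trace_def matrix_matrix_mult_def vec_lambda_beta
      by (intro continuous_intros X)
    then show ?thesis by (rule integrable_continuous_real)
  qed
  ultimately show "ereal s \<le> ereal (integral {0..1} (\<lambda>t. sqrt (nrm (X t))))"
    using D(2) by (auto intro!: has_integral_le[of D s] simp: has_integral_integral abs_le_iff)
qed

subsection \<open>Lengths of space-like geodesic segments\<close>

lemma HH_obtain:
  assumes "pt \<in> HH"
  obtains e where "form e e = -1" "pt = span {e}"
proof -
  obtain v where v: "pt = span {v}" "form v v < 0" using assms by (auto simp: HH_def)
  let ?k = "1 / sqrt (- form v v)"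
  have "form (?k *\<^sub>R v) (?k *\<^sub>R v) = -1"
    using v(2) by (simp add: form_simps field_simps)
  moreover have "span {?k *\<^sub>R v} = span {v}"
    using v(2) span_image_scale[of "{v}" "\<lambda>_. ?k"] by simp
  ultimately show ?thesis using that v(1) by metis
qed

lemma span_hyperboloid:
  assumes "form e e = -1" "form v v = -1" "span {v} = span {e}"
  shows "v = e \<or> v = - e"
proof -
  have "v \<in> span {e}" using assms(3) span_base[of v "{v}"] by simp
  then obtain k where k: "v = k *\<^sub>R e" by (auto simp: span_singleton)
  then have "k\<^sup>2 = 1" using assms(1,2) by (simp add: form_simps power2_eq_square)
  then have "k = 1 \<or> k = -1" by (simp add: power2_eq_1_iff)
  then show ?thesis using k by auto
qed

lemma in_span_pair: "x \<in> span {a, b} \<longleftrightarrow> (\<exists>k l. x = k *\<^sub>R a + l *\<^sub>R b)"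
  for x :: "'a::real_vector"
proof
  assume "x \<in> span {a, b}"
  then obtain k l where "x - k *\<^sub>R a = l *\<^sub>R b" by (auto simp: span_insert[of a] span_singleton)
  then have "x = k *\<^sub>R a + l *\<^sub>R b" by (simp add: diff_eq_eq add.commute)
  then show "\<exists>k l. x = k *\<^sub>R a + l *\<^sub>R b" by blast
qed (auto intro!: span_add span_scale simp: span_base)

lemma span_orthonormal:
  assumes "form e e = -1" "form u u = 1" "form e u = 0" "x \<in> span {e, u}"
  shows "x = (- form x e) *\<^sub>R e + form x u *\<^sub>R u"
proof -
  obtain k l where "x = k *\<^sub>R e + l *\<^sub>R u" using assms(4) by (auto simp: in_span_pair)
  then show ?thesis using assms(1-3) by (simp add: form_simps form_commute[of u e])
qed

lemma independent_orthonormal: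
  assumes "form e e = -1" "form u u = 1" "form e u = 0"
  shows "independent {e, u}" "card {e, u} = 2"
proof -
  have "e \<noteq> u" using assms by auto
  then show "card {e, u} = 2" by simp
  have u: "u \<noteq> 0" using assms(2) by (auto simp: form.zero_left)
  have "e \<notin> span {u}" using assms by (auto simp: span_singleton form_simps)
  with u show "independent {e, u}" by (simp add: independent_insert)
qed

lemma signature_1_1_span:
  assumes "form e e = -1" "form u u = 1" "form e u = 0"
  shows "signature_1_1 (span {e, u})"
proof -
  have "dim (span {e, u}) = 2"
    using independent_orthonormal[OF assms] by (metis dim_span dim_eq_card_independent)
  moreover have "e \<in> span {e, u}" "u \<in> span {e, u}" by (simp_all add: span_base)
  moreover have "form u u > 0" "form e e < 0" "form u e = 0"
    using assms by (simp_all add: form_commute)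
  ultimately show ?thesis
    unfolding signature_1_1_def by (meson subspace_span)
qed

text \<open>Making a positive vector orthogonal to \<open>e\<close> adds a square to its form value,
  so it stays positive and can be normalized.\<close>

lemma signature_1_1_basis:
  assumes "signature_1_1 P" "e \<in> P" "form e e = -1"
  obtains u where "form u u = 1" "form e u = 0" "P = span {e, u}"
proof -
  obtain u0 where u0: "u0 \<in> P" "form u0 u0 > 0" and P: "subspace P" "dim P = 2"
    using assms(1) by (auto simp: signature_1_1_def)
  define w where "w = u0 + form u0 e *\<^sub>R e"
  have "form w w = form u0 u0 + (form u0 e)\<^sup>2"
    using assms(3) by (simp add: w_def form_simps form_commute[of e u0] power2_eq_square)
  then have pos: "form w w > 0" using u0(2) by (simp add: add_pos_nonneg)
  have orth: "form e w = 0" using assms(3) by (simp add: w_def form_simps form_commute)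
  have w: "w \<in> P" unfolding w_def using u0(1) P(1) assms(2) by (simp add: subspace_add subspace_scale)
  define u where "u = (1 / sqrt (form w w)) *\<^sub>R w"
  have u: "form u u = 1" "form e u = 0" "u \<in> P"
    using pos orth w P(1) by (simp_all add: u_def form_simps subspace_scale)
  have "P \<subseteq> span {e, u}"
    using independent_orthonormal[OF assms(3) u(1,2)] u(3) assms(2) P(2)
    by (intro card_ge_dim_independent) auto
  moreover have "span {e, u} \<subseteq> P" using u(3) assms(2) P(1) by (simp add: span_minimal)
  ultimately show ?thesis using that u by blast
qed

text \<open>This gives the uniqueness behind \<open>ell\<close>. A lift moves on one branch of a
  hyperbola, injectivity makes its hyperbolic angle monotone, and the length is the total change of
  angle. The absolute value is there because the lines fix \<open>e\<close> and \<open>v\<close>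
  only up to sign.\<close>

lemma curve_length_eq:
  assumes "\<gamma> \<in> spacelike_geodesics" "segment_lift \<gamma> (span {e}) (span {v}) a b c"
    and ev: "form e e = -1" "form v v = -1" "\<bar>form e v\<bar> = cosh s" "s \<ge> 0"
  shows "curve_length a b c = s"
proof -
  have ab: "a \<le> b" and C1: "c C1_differentiable_on {a..b}" and inj: "inj_on c {a..b}"
    and hyp: "\<And>t. t \<in> {a..b} \<Longrightarrow> form (c t) (c t) = -1"
    and geo: "\<And>t. t \<in> {a..b} \<Longrightarrow> span {c t} \<in> \<gamma>"
    and ends: "span {c a} = span {e}" "span {c b} = span {v}"
    using assms(2) by (auto simp: segment_lift_def hyperboloid_def)
  obtain P where P: "signature_1_1 P" "\<gamma> = {x \<in> HH. x \<subseteq> P}"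
    using assms(1) by (auto simp: spacelike_geodesics_def)
  have cP: "c t \<in> P" if "t \<in> {a..b}" for t
    using geo[OF that] P(2) span_base[of "c t" "{c t}"] by auto
  \<comment> \<open>The actual start of the lift, which is \<open>e\<close> or \<open>- e\<close>,
    serves as the origin of the angle.\<close>
  define e' where "e' = c a"
  have e': "form e' e' = -1" "e' \<in> P" using hyp[of a] cP[of a] ab by (simp_all add: e'_def)
  obtain u where u: "form u u = 1" "form e' u = 0" "P = span {e', u}"
    using signature_1_1_basis[OF P(1) e'(2,1)] .
  define \<alpha> where "\<alpha> t = - form (c t) e'" for t
  define \<beta> where "\<beta> t = form (c t) u" for t
  define \<theta> where "\<theta> t = arsinh (\<beta> t)" for t
  obtain D where D: "\<And>t. t \<in> {a..b} \<Longrightarrow> (c has_vector_derivative D t) (at t)"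
    using C1 unfolding C1_differentiable_on_def by blast
  have cc: "continuous_on {a..b} c"
    using D by (intro continuous_at_imp_continuous_on ballI has_vector_derivative_continuous)
  have dec: "c t = \<alpha> t *\<^sub>R e' + \<beta> t *\<^sub>R u" if "t \<in> {a..b}" for t
    using span_orthonormal[OF e'(1) u(1,2)] cP[OF that] u(3) by (simp add: \<alpha>_def \<beta>_def)
  have \<alpha>2: "(\<alpha> t)\<^sup>2 = (\<beta> t)\<^sup>2 + 1" if "t \<in> {a..b}" for t
  proof -
    have "form (\<alpha> t *\<^sub>R e' + \<beta> t *\<^sub>R u) (\<alpha> t *\<^sub>R e' + \<beta> t *\<^sub>R u) = -1"
      using hyp[OF that] dec[OF that] by simp
    then show ?thesis using e'(1) u(1,2)
      by (simp add: form_simps form_commute[of u e'] power2_eq_square)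
  qed
  \<comment> \<open>Leaving the branch of the starting point would require a zero of \<alpha>, but
    its square is at least 1.\<close>
  have \<alpha>pos: "\<alpha> t > 0" if t: "t \<in> {a..b}" for t
  proof (rule ccontr)
    assume "\<not> \<alpha> t > 0"
    moreover have "\<alpha> a = 1" using e'(1) by (simp add: \<alpha>_def e'_def)
    moreover have "continuous_on {a..t} \<alpha>"
      unfolding \<alpha>_def using t
      by (intro continuous_on_minus form.continuous_on continuous_on_const continuous_on_subset[OF cc]) auto
    ultimately obtain r where "a \<le> r" "r \<le> t" "\<alpha> r = 0" using IVT2'[of \<alpha> t 0 a] t by auto
    then show False using \<alpha>2[of r] t by (simp add: add_nonneg_eq_0_iff)
  qed
  have ch: "\<alpha> t = cosh (\<theta> t)" if "t \<in> {a..b}" for t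
    using \<alpha>2[OF that] \<alpha>pos[OF that] by (simp add: \<theta>_def cosh_arsinh_real real_sqrt_unique)
  have sh: "\<beta> t = sinh (\<theta> t)" for t by (simp add: \<theta>_def)
  have c\<theta>: "c t = cosh (\<theta> t) *\<^sub>R e' + sinh (\<theta> t) *\<^sub>R u" if "t \<in> {a..b}" for t
    using dec[OF that] ch[OF that] sh by metis
  have cont: "continuous_on {a..b} \<theta>"
    unfolding \<theta>_def \<beta>_def
    by (intro continuous_on_arsinh' form.continuous_on continuous_on_const cc)
  have "inj_on \<theta> {a..b}"
    using inj c\<theta> unfolding inj_on_def by metis
  \<comment> \<open>A continuous injective real function on an interval is monotone; \<epsilon>
    records the direction as 1 or -1.\<close>
  then have "mono_on {a..b} \<theta> \<or> mono_on {a..b} (\<lambda>t. - \<theta> t)"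
    using injective_eq_monotone_map[of "{a..b}" \<theta>] cont
    by (auto simp: is_interval_cc monotone_on_def order_le_less)
  then obtain \<epsilon> :: real where \<epsilon>: "\<epsilon>\<^sup>2 = 1" "mono_on {a..b} (\<lambda>t. \<epsilon> * \<theta> t)"
    by (metis (no_types, lifting) ext mult_1 mult_minus1 power2_minus power_one)
  define \<theta>' where "\<theta>' t = form (D t) u / sqrt ((\<beta> t)\<^sup>2 + 1)" for t
  have d\<theta>: "(\<theta> has_real_derivative \<theta>' t) (at t)" if "t \<in> {a..b}" for t
  proof -
    have "(\<beta> has_real_derivative form (D t) u) (at t)"
      unfolding \<beta>_def has_real_derivative_iff_has_vector_derivative
      by (rule bounded_linear.has_vector_derivative[OF form.bounded_linear_left D[OF that]])
    from DERIV_chain2[OF arsinh_real_has_field_derivative this]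
    moreover have "\<theta> = (\<lambda>t. arsinh (\<beta> t))" by (simp add: \<theta>_def fun_eq_iff)
    ultimately show ?thesis by (simp add: \<theta>'_def)
  qed
  \<comment> \<open>Only interior points are treated: the angle describes \<open>c\<close> on
    \<open>{a..b}\<close> alone, while the derivative is two-sided. The version of the fundamental
    theorem used below asks for no more.\<close>
  have speed: "sqrt (form (vector_derivative c (at t)) (vector_derivative c (at t))) = \<epsilon> * \<theta>' t"
    if t: "t \<in> {a<..<b}" for t
  proof -
    let ?w = "(sinh (\<theta> t) * \<theta>' t) *\<^sub>R e' + (cosh (\<theta> t) * \<theta>' t) *\<^sub>R u"
    have "((\<lambda>t. cosh (\<theta> t) *\<^sub>R e' + sinh (\<theta> t) *\<^sub>R u) has_vector_derivative ?w) (at t)"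
      using d\<theta>[of t] t
      by (auto intro!: derivative_eq_intros simp: has_real_derivative_iff_has_vector_derivative[symmetric])
    then have "(c has_vector_derivative ?w) (at t)"
      by (rule has_vector_derivative_transform_within_open[of _ _ _ "{a<..<b}"]) (use t c\<theta> in auto)
    then have "vector_derivative c (at t) = ?w" by (rule vector_derivative_at)
    moreover have "form ?w ?w = (\<theta>' t)\<^sup>2 * ((cosh (\<theta> t))\<^sup>2 - (sinh (\<theta> t))\<^sup>2)"
      using e'(1) u(1,2) by (simp add: form_simps form_commute[of u e'] power2_eq_square algebra_simps)
    moreover have "\<epsilon> * \<theta>' t \<ge> 0"
    proof (rule mono_on_imp_deriv_nonneg[OF \<epsilon>(2)])
      show "((\<lambda>t. \<epsilon> * \<theta> t) has_real_derivative \<epsilon> * \<theta>' t) (at t)"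
        using d\<theta>[of t] t by (intro DERIV_cmult) auto
    qed (use t in simp)
    moreover have "(\<theta>' t)\<^sup>2 = (\<epsilon> * \<theta>' t)\<^sup>2" using \<epsilon>(1) by (simp add: power_mult_distrib)
    ultimately show ?thesis by (simp add: hyperbolic_pythagoras)
  qed
  have "((\<lambda>t. sqrt (form (vector_derivative c (at t)) (vector_derivative c (at t))))
      has_integral \<epsilon> * \<theta> b - \<epsilon> * \<theta> a) {a..b}"
  proof (rule fundamental_theorem_of_calculus_interior[OF ab])
    show "continuous_on {a..b} (\<lambda>t. \<epsilon> * \<theta> t)" by (intro continuous_intros cont)
    show "((\<lambda>t. \<epsilon> * \<theta> t) has_vector_derivative
        sqrt (form (vector_derivative c (at t)) (vector_derivative c (at t)))) (at t)"
      if "t \<in> {a<..<b}" for t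
      unfolding speed[OF that] has_real_derivative_iff_has_vector_derivative[symmetric]
      using d\<theta>[of t] that by (intro DERIV_cmult) auto
  qed
  moreover have \<theta>a: "\<theta> a = 0" using u(2) by (simp add: \<theta>_def \<beta>_def e'_def)
  ultimately have len: "curve_length a b c = \<epsilon> * \<theta> b"
    by (simp add: curve_length_def integral_unique)
  have "\<epsilon> * \<theta> a \<le> \<epsilon> * \<theta> b" using \<epsilon>(2) ab by (auto simp: monotone_on_def)
  then have nn: "\<epsilon> * \<theta> b \<ge> 0" using \<theta>a by simp
  have "\<epsilon> = 1 \<or> \<epsilon> = -1" using \<epsilon>(1) by (simp add: power2_eq_1_iff)
  then have "cosh (\<epsilon> * \<theta> b) = cosh (\<theta> b)" by auto
  also have "\<dots> = \<bar>\<alpha> b\<bar>" using ch[of b] \<alpha>pos[of b] ab by simp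
  \<comment> \<open>Replacing an endpoint of the lift by its negative only changes a sign, which the
    absolute value removes.\<close>
  also have "\<dots> = \<bar>form v e\<bar>"
    using span_hyperboloid[OF ev(1) _ ends(1)] span_hyperboloid[OF ev(2) _ ends(2)] hyp[of a] hyp[of b] ab
    by (auto simp: \<alpha>_def e'_def form_simps)
  also have "\<dots> = cosh s" using ev(3) by (simp add: form_commute)
  finally have "\<bar>\<epsilon> * \<theta> b\<bar> = \<bar>s\<bar>" by (simp only: cosh_real_eq_iff)
  then show ?thesis using len nn ev(4) by simp
qed

lemma span_scale_hyperboloid: "form v v = -1 \<Longrightarrow> span {v} \<in> HH"
  by (auto simp: HH_def intro!: exI[of _ v])

text \<open>The arc-length path witnesses the value and \<open>curve_length_eq\<close> makes it
  unique. For \<open>s = 0\<close> several geodesics may pass through the point, but they all give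
  length 0.\<close>

lemma ell_eq:
  assumes "form e e = -1" "form u u = 1" "form e u = 0" "s \<ge> 0"
  shows "ell (span {e}) (span {cosh s *\<^sub>R e + sinh s *\<^sub>R u}) = s"
proof -
  let ?c = "\<lambda>t. cosh t *\<^sub>R e + sinh t *\<^sub>R u"
  let ?D = "\<lambda>t. sinh t *\<^sub>R e + cosh t *\<^sub>R u"
  let ?\<gamma> = "{x \<in> HH. x \<subseteq> span {e, u}}"
  have f: "form (?c t) (?c t) = -1" for t
    using assms(1-3) cosh_square_eq[of t]
    by (simp add: form_simps form_commute[of u e] power2_eq_square)
  have D: "(?c has_vector_derivative ?D t) (at t)" for t
    by (auto intro!: derivative_eq_intros simp: has_real_derivative_iff_has_vector_derivative[symmetric])
  have \<gamma>: "?\<gamma> \<in> spacelike_geodesics"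
    using signature_1_1_span[OF assms(1-3)] by (auto simp: spacelike_geodesics_def)
  have in\<gamma>: "span {?c t} \<in> ?\<gamma>" for t
  proof -
    have "?c t \<in> span {e, u}" by (auto simp: in_span_pair)
    then show ?thesis using span_scale_hyperboloid[OF f] by (simp add: span_minimal)
  qed
  have inj: "inj_on ?c {0..s}"
  proof (rule inj_onI)
    fix x y assume "?c x = ?c y"
    then have "form (?c x) u = form (?c y) u" by simp
    then show "x = y" using assms(2,3) by (simp add: form_simps)
  qed
  have "?c C1_differentiable_on {0..s}"
    unfolding C1_differentiable_on_def using D
    by (intro exI[of _ ?D] conjI ballI continuous_intros) auto
  then have lift: "segment_lift ?\<gamma> (span {e}) (span {?c s}) 0 s ?c"
    using assms(4) inj in\<gamma> f by (simp add: segment_lift_def hyperboloid_def)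
  have "\<bar>form e (?c s)\<bar> = cosh s" using assms by (simp add: form_simps abs_mult)
  note len = curve_length_eq[OF _ _ assms(1) f this assms(4)]
  show ?thesis
    unfolding ell_def
  proof (rule the_equality)
    show "\<exists>\<gamma>\<in>spacelike_geodesics. \<exists>a b c. segment_lift \<gamma> (span {e}) (span {?c s}) a b c
        \<and> s = curve_length a b c"
      using \<gamma> lift len by (metis (no_types, lifting))
  qed (use len in auto)
qed

subsection \<open>The group PSO(p,q)\<close>

lemma psl_mult_class:
  fixes A B :: "real ^ 'n ^ 'n"
  assumes "det A = 1" "det B = 1"
  shows "psl_mult (psl_class A) (psl_class B) = psl_class (A ** B)"
proof (intro equalityI subsetI)
  fix C assume "C \<in> psl_mult (psl_class A) (psl_class B)"
  then obtain c c' where "C = (c *\<^sub>R A) ** (c' *\<^sub>R B)" "det (c *\<^sub>R A) = 1" "det (c' *\<^sub>R B) = 1"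
    by (auto simp: psl_mult_def psl_class_def)
  moreover from this have "det C = 1" by (simp only: det_mul)
  ultimately have "C = (c' * c) *\<^sub>R (A ** B)" "det C = 1"
    by (simp_all only: mm.scaleR_left mm.scaleR_right scaleR_scaleR mult.commute)
  then show "C \<in> psl_class (A ** B)" by (auto simp: psl_class_def)
next
  fix C assume "C \<in> psl_class (A ** B)"
  then obtain c where c: "C = (c *\<^sub>R A) ** B" "det C = 1"
    by (auto simp: psl_class_def mm.scaleR_left)
  \<comment> \<open>The whole scalar is put on \<open>A\<close>; since \<open>det B = 1\<close>, the
    scaled \<open>A\<close> is again a representative.\<close>
  then have "det (c *\<^sub>R A) = 1" using assms(2) by (simp add: det_mul)
  then have "c *\<^sub>R A \<in> psl_class A" by (auto simp: psl_class_def)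
  moreover have "B \<in> psl_class B" using assms(2) by (auto simp: psl_class_def intro: exI[of _ 1])
  ultimately show "C \<in> psl_mult (psl_class A) (psl_class B)"
    using c(1) by (auto simp: psl_mult_def)
qed

lemma SO_pq_det: "A \<in> SO_pq \<Longrightarrow> det A = 1"
  and SO_pq_O: "A \<in> SO_pq \<Longrightarrow> A \<in> O_pq"
  by (simp_all add: SO_pq_iff)

lemma SO_pq_mult: "A \<in> SO_pq \<Longrightarrow> B \<in> SO_pq \<Longrightarrow> A ** B \<in> SO_pq"
  by (simp add: SO_pq_iff O_pq_mult det_mul)

lemma SO_pq_adj: "A \<in> SO_pq \<Longrightarrow> adj A \<in> SO_pq"
  by (simp add: SO_pq_iff O_pq_adj det_adj)

lemma image_span_single: "(*v) A ` span {x} = span {A *v x}" for A :: "real ^ 'n ^ 'm"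
  using linear_span_image[of "(*v) A" "{x}"] by simp

lemma psl_act_span:
  "A \<in> SO_pq \<Longrightarrow> psl_act (psl_class A) (span {x}) = span {A *v x}"
  by (simp add: psl_act_class SO_pq_det image_span_single)

lemma stabilizerD:
  assumes "g \<in> stabilizer (span {e})" "form e e = -1"
  obtains A where "A \<in> SO_pq" "g = psl_class A" "A *v e = e \<or> A *v e = - e"
proof -
  obtain A where A: "A \<in> SO_pq" "g = psl_class A"
    using assms(1) by (auto simp: stabilizer_def PSO_pq_def)
  then have "span {A *v e} = span {e}" using assms(1) by (simp add: stabilizer_def psl_act_span)
  moreover have "form (A *v e) (A *v e) = -1"
    using O_pq_form[OF SO_pq_O[OF A(1)]] assms(2) by simp
  ultimately show ?thesis using that A span_hyperboloid[OF assms(2)] by blast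
qed

lemma span_minus_single: "span {- x} = span {x}" for x :: "'a::real_vector"
  using span_image_scale[of "{x}" "\<lambda>_. -1"] by simp

lemma stabilizerI:
  assumes "A \<in> SO_pq" "A *v e = e \<or> A *v e = - e"
  shows "psl_class A \<in> stabilizer (span {e})"
proof -
  have "span {A *v e} = span {e}"
    using assms(2) by (rule disjE) (simp_all only: span_minus_single)
  then show ?thesis using assms(1) by (simp add: stabilizer_def PSO_pq_def psl_act_span)
qed

text \<open>Two isometric representatives of a class differ by a scalar of square 1, so this
  absolute value is an invariant of the class. It will identify the chamber component.\<close>

lemma psl_class_eqD:
  assumes "psl_class A = psl_class B" "A \<in> SO_pq" "B \<in> SO_pq" "form e e = -1"
  shows "\<bar>form e (A *v e)\<bar> = \<bar>form e (B *v e)\<bar>"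
proof -
  have "A \<in> psl_class A" using assms(2) by (auto simp: psl_class_def SO_pq_det intro: exI[of _ 1])
  then obtain c where c: "A = c *\<^sub>R B" using assms(1) by (auto simp: psl_class_def)
  have "form (A *v e) (A *v e) = c\<^sup>2 * form (B *v e) (B *v e)"
    by (simp add: c mv.scaleR_left form_simps power2_eq_square)
  then have "c\<^sup>2 = 1"
    using assms(4) O_pq_form[OF SO_pq_O[OF assms(2)], of e e] O_pq_form[OF SO_pq_O[OF assms(3)], of e e]
    by simp
  then have "\<bar>c\<bar> = 1" by (simp add: abs_square_eq_1)
  then show ?thesis by (simp add: c mv.scaleR_left form_simps abs_mult)
qed

lemma psl_act_SS:
  assumes "A \<in> SO_pq"
  shows "psl_act (psl_class A) ` SS (span {e}) = SS (span {A *v e})"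
proof -
  note O = SO_pq_O[OF assms]
  have act: "psl_act (psl_class A) \<tau> = (*v) A ` \<tau>" if "\<tau> \<in> SS (span {e})" for \<tau>
    using that by (intro psl_act_class SO_pq_det assms XG_subspace) (simp add: SS_def)
  show ?thesis
  proof (intro equalityI subsetI)
    fix \<rho> assume "\<rho> \<in> psl_act (psl_class A) ` SS (span {e})"
    then obtain \<tau> where \<tau>: "\<tau> \<in> SS (span {e})" "\<rho> = (*v) A ` \<tau>" using act by auto
    then have "(*v) A ` span {e} \<subseteq> \<rho>" by (auto simp: SS_def)
    then show "\<rho> \<in> SS (span {A *v e})"
      using \<tau> XG_image[OF O] by (simp add: SS_def image_span_single)
  next
    fix \<rho> assume \<rho>: "\<rho> \<in> SS (span {A *v e})"
    let ?\<tau> = "(*v) (adj A) ` \<rho>"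
    have "(*v) (adj A) ` span {A *v e} \<subseteq> ?\<tau>" using \<rho> by (auto simp: SS_def)
    then have \<tau>: "?\<tau> \<in> SS (span {e})"
      using \<rho> XG_image[OF O_pq_adj[OF O]] by (simp add: SS_def image_span_single O_pq_inv[OF O])
    moreover have "\<rho> = psl_act (psl_class A) ?\<tau>"
      unfolding act[OF \<tau>] by (simp add: image_image O_pq_inv[OF O])
    ultimately show "\<rho> \<in> psl_act (psl_class A) ` SS (span {e})" by blast
  qed
qed

text \<open>In a plane of signature (1,1) containing \<open>e\<close>, the coordinates of
  \<open>A *v e\<close> satisfy the equation of a hyperbola, which gives the parameter
  \<open>s\<close>. Both signs of the vector remain possible because only its line is a point of
  \<open>HH\<close>.\<close>

lemma CCG_obtain:
  assumes "g \<in> CCG (span {e})" "form e e = -1"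
  obtains A u s where "A \<in> SO_pq" "g = psl_class A" "form u u = 1" "form e u = 0" "s \<ge> 0"
    "A *v e = cosh s *\<^sub>R e + sinh s *\<^sub>R u \<or> A *v e = - (cosh s *\<^sub>R e + sinh s *\<^sub>R u)"
proof -
  obtain A where A: "A \<in> SO_pq" "g = psl_class A" using assms(1) by (auto simp: CCG_def PSO_pq_def)
  have "span {A *v e} \<in> CC (span {e})" using assms(1) A by (simp add: CCG_def psl_act_span)
  then obtain P where P: "signature_1_1 P" "span {e} \<subseteq> P" "span {A *v e} \<subseteq> P"
    by (auto simp: CC_def spacelike_geodesics_def)
  then have "e \<in> P" "A *v e \<in> P" using span_base[of e "{e}"] span_base[of "A *v e" "{A *v e}"] by auto
  then obtain u where u: "form u u = 1" "form e u = 0" "A *v e \<in> span {e, u}"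
    using signature_1_1_basis[OF P(1) _ assms(2)] by metis
  then obtain a b where ab: "A *v e = a *\<^sub>R e + b *\<^sub>R u" by (auto simp: in_span_pair)
  have "form (A *v e) (A *v e) = -1" using O_pq_form[OF SO_pq_O[OF A(1)]] assms(2) by simp
  then have "a\<^sup>2 = b\<^sup>2 + 1"
    using assms(2) u(1,2) by (simp add: ab form_simps form_commute[of u e] power2_eq_square)
  then have "cosh (arsinh \<bar>b\<bar>) = \<bar>a\<bar>" by (metis cosh_arsinh_real power2_abs real_sqrt_abs)
  moreover have "sinh (arsinh \<bar>b\<bar>) = \<bar>b\<bar>" by simp
  moreover define s where "s = arsinh \<bar>b\<bar>"
  ultimately have s: "cosh s = \<bar>a\<bar>" "sinh s = \<bar>b\<bar>" by auto
  have s0: "s \<ge> 0" unfolding s_def using arsinh_real_neg_iff[of "\<bar>b\<bar>"] by linarith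
  \<comment> \<open>The relative sign of the coordinates is absorbed into \<open>u\<close>; the
    common sign chooses the alternative in the conclusion.\<close>
  define \<delta> :: real where "\<delta> = (if a * b \<ge> 0 then 1 else -1)"
  have "form (\<delta> *\<^sub>R u) (\<delta> *\<^sub>R u) = 1" "form e (\<delta> *\<^sub>R u) = 0"
    using u(1,2) by (simp_all add: \<delta>_def form_simps)
  moreover have "A *v e = cosh s *\<^sub>R e + sinh s *\<^sub>R \<delta> *\<^sub>R u
      \<or> A *v e = - (cosh s *\<^sub>R e + sinh s *\<^sub>R \<delta> *\<^sub>R u)"
    unfolding s ab \<delta>_def by (auto simp: abs_if zero_le_mult_iff not_le)
  ultimately show ?thesis using that A s0 by blast
qed

subsection \<open>Infinitesimal transvections\<close>

lemma perp_span: "perp (span {e}) = {y. form e y = 0}"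
  by (auto simp: perp_def span_singleton form_simps intro: exI[of _ 1])

lemma JJ_eq:
  assumes "form e e = -1"
  shows "JJ (span {e}) = - reflection e"
  unfolding JJ_def perp_span
proof (rule the_equality)
  have R: "- reflection e *v x = - x - (2 * form e x) *\<^sub>R e" for x
    using assms by (simp add: mv.minus_left reflection_mult_vec)
  have "- reflection e *v (k *\<^sub>R e) = k *\<^sub>R e" for k
  proof -
    have "- reflection e *v (k *\<^sub>R e) = (- k - 2 * form e (k *\<^sub>R e)) *\<^sub>R e"
      unfolding R by (simp add: scaleR_diff_left)
    then show ?thesis using assms by (simp add: form_simps)
  qed
  then show "(\<forall>x\<in>span {e}. - reflection e *v x = x) \<and> (\<forall>y\<in>{y. form e y = 0}. - reflection e *v y = - y)"
    by (auto simp: span_singleton R)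
  fix J assume J: "(\<forall>x\<in>span {e}. J *v x = x) \<and> (\<forall>y\<in>{y. form e y = 0}. J *v y = - y)"
  show "J = - reflection e"
  proof (rule matrix_eqI)
    fix x
    let ?y = "x + form e x *\<^sub>R e"
    have "form e ?y = 0" using assms by (simp add: form_simps)
    then have "J *v ?y = - ?y" using J by blast
    moreover have "J *v e = e" using J span_base[of e "{e}"] by blast
    ultimately have "J *v x + form e x *\<^sub>R e = - x - form e x *\<^sub>R e" by (simp add: mv_simps)
    then show "J *v x = - reflection e *v x"
      unfolding R mult_2 scaleR_add_left by (metis add_diff_cancel_right' diff_diff_eq)
  qed
qed

text \<open>The reflection condition forces \<open>X\<close> to map the complement of
  \<open>e\<close> into the line of \<open>e\<close>, and skewness gives the coefficient. Hence an
  element of \<open>qq\<close> is determined by its value at \<open>e\<close>.\<close>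

lemma qq_apply:
  assumes "X \<in> qq (span {e})" "form e e = -1"
  shows "X *v x = form x (X *v e) *\<^sub>R e - form x e *\<^sub>R (X *v e)"
proof -
  let ?R = "reflection e"
  have so: "X \<in> so_pq" and J: "?R ** X ** ?R = - X"
    using assms by (auto simp: qq_def JJ_eq mm.minus_left mm.minus_right)
  \<comment> \<open>The component of \<open>x\<close> orthogonal to \<open>e\<close>; the plus sign
    comes from \<open>form e e = -1\<close>.\<close>
  let ?y = "x + form e x *\<^sub>R e"
  have y: "form e ?y = 0" using assms(2) by (simp add: form_simps)
  have "?R ** X ** ?R *v ?y = - (X *v ?y)" by (simp only: J mv.minus_left)
  then have "?R *v (X *v (?R *v ?y)) = - (X *v ?y)" by (simp only: matrix_vector_mul_assoc matrix_mul_assoc)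
  then have "X *v ?y + (2 * form e (X *v ?y)) *\<^sub>R e = - (X *v ?y)"
    unfolding reflection_orth[OF y] using assms(2) by (simp add: reflection_mult_vec)
  moreover have "a = (- f) *\<^sub>R e" if "a + (2 * f) *\<^sub>R e = - a" for a f
  proof -
    have "a $ i = - (f * e $ i)" for i
    proof -
      have "a $ i + 2 * (f * e $ i) = - a $ i"
        using arg_cong[OF that, of "\<lambda>z. z $ i"] by simp
      then show ?thesis by linarith
    qed
    then show ?thesis by (simp add: vec_eq_iff)
  qed
  ultimately have "X *v ?y = (- form e (X *v ?y)) *\<^sub>R e" by blast
  moreover have "form e (X *v ?y) = - form ?y (X *v e)"
    using so_pq_skew[OF so, of e ?y] by (simp add: form_commute)
  moreover have "form e (X *v e) = 0" using so_pq_skew_self[OF so] by (simp add: form_commute)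
  ultimately have "X *v ?y = form x (X *v e) *\<^sub>R e" by (simp add: form_simps)
  then show ?thesis by (simp add: mv_simps form_commute[of e x] eq_diff_eq)
qed

text \<open>\<open>X ** X\<close> is the projection onto the plane of \<open>e\<close> and
  \<open>w\<close>, whose trace is 2.\<close>

lemma nrm_transvection:
  fixes e w :: "('p::finite, 'q::finite) vpq"
  assumes "CARD('p) + CARD('q) > 2"
    and "\<And>x. X *v x = form x w *\<^sub>R e - form x e *\<^sub>R w"
    and "form e e = -1" "form w w = 1" "form e w = 0"
  shows "nrm X = 1"
proof -
  have tr: "trace (outer a b) = a \<bullet> b" for a b :: "('p, 'q) vpq"
    by (simp add: trace_def outer_def inner_vec_def)
  have XX: "X ** X = outer w (sgn_mat *v w) - outer e (sgn_mat *v e)"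
  proof (rule matrix_eqI)
    fix x
    show "X ** X *v x = (outer w (sgn_mat *v w) - outer e (sgn_mat *v e)) *v x"
      using assms(3-5)
      by (simp add: assms(2) mv.diff_left outer_mult_vec inner_sgn_mat form_simps form_commute[of _ x]
          form_commute[of w e] flip: matrix_vector_mul_assoc form_inner)
  qed
  have "trace (X ** X) = form w w - form e e"
    unfolding XX by (simp add: trace_sub tr form_inner)
  then show ?thesis using assms(3,4) by (simp add: nrm_eq[OF assms(1)])
qed

lemma nrm_scaleR: "nrm (s *\<^sub>R X) = s\<^sup>2 * nrm X"
proof -
  have "trace (c *\<^sub>R Y) = c * trace Y" for c and Y :: "('a, 'b) mpq"
    by (simp add: trace_def sum_distrib_left)
  then show ?thesis
    by (simp add: nrm_def killing_def mm.scaleR_left mm.scaleR_right power2_eq_square)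
qed

text \<open>\<open>e + u\<close> and \<open>e - u\<close> are mapped by \<open>Y\<close> to their
  multiples by \<open>s\<close> and \<open>- s\<close>.\<close>

lemma mexp_boost:
  fixes Y :: "real ^ 'n ^ 'n"
  assumes "Y *v e = s *\<^sub>R u" "Y *v u = s *\<^sub>R e"
  shows "mexp Y *v e = cosh s *\<^sub>R e + sinh s *\<^sub>R u"
proof -
  have p: "mexp Y *v (e + u) = exp s *\<^sub>R (e + u)"
    by (rule mexp_eigenvector) (simp add: mv_simps assms algebra_simps)
  have m: "mexp Y *v (e - u) = exp (- s) *\<^sub>R (e - u)"
    by (rule mexp_eigenvector) (simp add: mv_simps assms algebra_simps)
  have "e = (1/2) *\<^sub>R (e + u) + (1/2) *\<^sub>R (e - u)"
    by (simp add: algebra_simps flip: scaleR_add_left)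
  then have "mexp Y *v e = (1/2) *\<^sub>R (mexp Y *v (e + u)) + (1/2) *\<^sub>R (mexp Y *v (e - u))"
    by (metis mv.add_right mv.scaleR_right)
  also have "\<dots> = ((exp s + exp (- s)) / 2) *\<^sub>R e + ((exp s - exp (- s)) / 2) *\<^sub>R u"
    unfolding p m by (simp add: scaleR_add_right scaleR_diff_right add_divide_distrib
        diff_divide_distrib scaleR_add_left scaleR_diff_left)
  finally show ?thesis by (simp only: cosh_field_def sinh_field_def)
qed

lemma ip_scaleR_left: "ip \<tau> (c *\<^sub>R x) y = c * ip \<tau> x y"
  by (simp add: ip_def mv.scaleR_right form_simps algebra_simps)

lemma ip_scaleR_right: "ip \<tau> x (c *\<^sub>R y) = c * ip \<tau> x y"
  using ip_scaleR_left[of \<tau> c y x] by (simp add: ip_commute)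

lemma pp_scaleR: "X \<in> pp \<tau> \<Longrightarrow> s *\<^sub>R X \<in> pp \<tau>"
  by (simp add: pp_def so_pq_scaleR mv.scaleR_left ip_scaleR_left ip_scaleR_right)

text \<open>The two sides differ by a multiple of \<open>ip \<tau> e u\<close>, which is
  \<open>- form e u\<close> because \<open>e\<close> lies in \<tau>.\<close>

lemma ip_isotropic:
  assumes "\<tau> \<in> XG" "e \<in> \<tau>" "form e u = 0"
  shows "ip \<tau> (e - u) (e - u) = ip \<tau> (e + u) (e + u)"
proof -
  have P: "proj \<tau> *v e = e" using XG_is_proj[OF assms(1)] assms(2) by (simp add: is_proj_def)
  have "form (proj \<tau> *v u) e = form u e"
    using proj_form[OF XG_is_proj[OF assms(1)], of u e] P by simp
  then show ?thesis
    using assms(3) by (simp add: ip_eq[OF assms(1)] mv_simps form_simps P form_commute[of u e])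
qed

text \<open>\<open>ip_isotropic\<close> is used twice: at \<sigma> for \<open>e\<close> and
  \<open>u\<close>, and at \<rho> for the boosted pair \<open>v\<close> and \<open>w\<close>, which
  spans the same two isotropic lines.\<close>

lemma dXG_SS_ge:
  fixes e u :: "('p::finite, 'q::finite) vpq"
  assumes "CARD('p) + CARD('q) > 2"
    and eu: "form e e = -1" "form u u = 1" "form e u = 0"
    and "\<sigma> \<in> SS (span {e})" "\<rho> \<in> SS (span {cosh s *\<^sub>R e + sinh s *\<^sub>R u})"
  shows "dXG \<sigma> \<rho> \<ge> ereal s"
proof -
  let ?m = "e - u" and ?n = "e + u"
  define v where "v = cosh s *\<^sub>R e + sinh s *\<^sub>R u"
  define w where "w = sinh s *\<^sub>R e + cosh s *\<^sub>R u"
  have \<sigma>: "\<sigma> \<in> XG" "e \<in> \<sigma>" using assms(5) span_base[of e "{e}"] by (auto simp: SS_def)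
  have \<rho>: "\<rho> \<in> XG" "v \<in> \<rho>" using assms(6) span_base[of v "{v}"] by (auto simp: SS_def v_def)
  have nz: "?m \<noteq> 0" "?n \<noteq> 0"
  proof -
    have "form e ?m = -1" "form e ?n = -1" using eu by (simp_all add: form_simps)
    then show "?m \<noteq> 0" "?n \<noteq> 0" by (metis form.zero_right neg_equal_0_iff_equal zero_neq_one)+
  qed
  have vw: "form v w = 0" using eu by (simp add: v_def w_def form_simps form_commute[of u e])
  \<comment> \<open>The boost scales the isotropic vectors by \<open>exp (- s)\<close> and
    \<open>exp s\<close>. Squares in \<open>ip \<rho>\<close> then differ by the factor
    \<open>exp (4 * s)\<close>, the source of \<open>4 * s\<close> in \<open>dXG_ge\<close>.\<close>
  have "v - w = exp (- s) *\<^sub>R ?m" "v + w = exp s *\<^sub>R ?n"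
    by (simp_all add: v_def w_def algebra_simps flip: cosh_minus_sinh cosh_plus_sinh)
  then have "?m = exp s *\<^sub>R (v - w)" "?n = exp (- s) *\<^sub>R (v + w)"
    by (simp_all flip: exp_add)
  then have "ip \<rho> ?m ?m = (exp s)\<^sup>2 * ip \<rho> (v - w) (v - w)"
    "ip \<rho> ?n ?n = (exp (- s))\<^sup>2 * ip \<rho> (v - w) (v - w)"
    using ip_isotropic[OF \<rho> vw] by (simp_all add: ip_scaleR_left ip_scaleR_right power2_eq_square)
  moreover have "ip \<rho> (v - w) (v - w) > 0"
    using nz(1) \<open>v - w = exp (- s) *\<^sub>R ?m\<close> by (intro ip_pos[OF \<rho>(1)]) simp
  ultimately have "ln (ip \<rho> ?m ?m) - ln (ip \<rho> ?n ?n) = 4 * s"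
    by (simp add: ln_mult ln_realpow)
  moreover have "ip \<sigma> ?m ?m = ip \<sigma> ?n ?n" by (rule ip_isotropic[OF \<sigma> eu(3)])
  ultimately show ?thesis by (intro dXG_ge[OF assms(1) nz]) simp
qed

section \<open>Evaluation of length, chamber projection and distance at the common value\<close>

theorem proposition3p8:
  fixes pt \<tau> :: "('p::finite, 'q::finite) vpq set"
    and B C :: "('p, 'q) mpq set"
    and g :: "('p, 'q) mpq set"
  assumes "CARD('p) + CARD('q) > 2"
    and "pt \<in> HH"
    and "\<tau> \<in> SS pt"
    and "maximal_subalgebra_in B (pp \<tau> \<inter> qq pt)"
    and "closed_weyl_chamber B C"
    and "g \<in> CCG pt"
  shows "ell pt (psl_act g pt) = sqrt (nrm (bb pt C g))
    \<and> ereal (sqrt (nrm (bb pt C g))) = dXG_set (SS pt) (psl_act g ` SS pt)"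
proof -
  note d = assms(1)
  obtain e where e: "form e e = -1" and pt: "pt = span {e}" using HH_obtain[OF assms(2)] .
  have \<tau>: "\<tau> \<in> XG" "e \<in> \<tau>" using assms(3) span_base[of e "{e}"] by (auto simp: SS_def pt)
  obtain X0 where X0: "X0 \<in> B" "X0 \<noteq> 0" and C0: "C = {s *\<^sub>R X0 | s. s \<ge> 0}"
    using assms(5) by (auto simp: closed_weyl_chamber_def)
  have X0': "X0 \<in> pp \<tau>" "X0 \<in> qq (span {e})"
    using assms(4) X0(1) by (auto simp: maximal_subalgebra_in_def pt)
  have X0so: "X0 \<in> so_pq" using X0'(1) by (simp add: pp_def)
  define w0 where "w0 = X0 *v e"
  note X0x = qq_apply[OF X0'(2) e, folded w0_def]
  have "w0 \<noteq> 0"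
  proof
    assume "w0 = 0"
    then have "X0 = 0" by (intro matrix_eqI) (simp add: X0x form.zero_right)
    then show False using X0(2) by simp
  qed
  \<comment> \<open>Symmetry for \<open>ip \<tau>\<close> and skewness for \<open>form\<close> give
    this product opposite signs. Thus \<open>X0\<close> moves \<open>e\<close> into
    \<open>perp \<tau>\<close>, where \<open>ip \<tau>\<close> agrees with \<open>form\<close> and
    is positive.\<close>
  have "form w0 a = 0" if "a \<in> \<tau>" for a
  proof -
    have "ip \<tau> w0 a = ip \<tau> e (X0 *v a)" using X0'(1) by (simp add: pp_def w0_def)
    then have "form a w0 = form e (X0 *v a)"
      using ip_in[OF \<tau>(1) that, of w0] ip_in[OF \<tau>] by (simp add: ip_commute)
    then show ?thesis using so_pq_skew[OF X0so, of e a] by (simp add: w0_def form_commute)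
  qed
  then have "w0 \<in> perp \<tau>" by (simp add: perp_def form_commute)
  then have "proj \<tau> *v w0 = 0" using XG_is_proj[OF \<tau>(1)] by (simp add: is_proj_def)
  then have w0pos: "form w0 w0 > 0"
    using ip_pos[OF \<tau>(1) \<open>w0 \<noteq> 0\<close>] by (simp add: ip_eq[OF \<tau>(1)] form.zero_left)
  define r where "r = sqrt (form w0 w0)"
  have r: "r > 0" using w0pos by (simp add: r_def)
  \<comment> \<open>Normalizing by the positive number \<open>r\<close> gives a unit transvection
    and leaves the half-line \<open>C\<close> unchanged.\<close>
  define X where "X = (1 / r) *\<^sub>R X0"
  define w where "w = (1 / r) *\<^sub>R w0"
  have w: "form w w = 1" "form e w = 0"
    using w0pos so_pq_skew_self[OF X0so, of e]
    by (simp_all add: w_def r_def form_simps form_commute w0_def)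
  have Xx: "X *v x = form x w *\<^sub>R e - form x e *\<^sub>R w" for x
    by (simp add: X_def mv.scaleR_left X0x w_def form_simps scaleR_diff_right)
  have Xe: "X *v e = w" "X *v w = e" using e w by (simp_all add: Xx form_commute)
  have Xpp: "X \<in> pp \<tau>" unfolding X_def by (rule pp_scaleR[OF X0'(1)])
  then have Xso: "X \<in> so_pq" by (simp add: pp_def)
  have nrmX: "nrm (s *\<^sub>R X) = s\<^sup>2" for s
    using nrm_transvection[OF d Xx e w] by (simp add: nrm_scaleR)
  have C: "C = {s *\<^sub>R X | s. s \<ge> 0}"
  proof -
    have "s *\<^sub>R X0 = (s * r) *\<^sub>R X" "s *\<^sub>R X = (s / r) *\<^sub>R X0" for s
      using r by (simp_all add: X_def)
    then show ?thesis unfolding C0 using r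
      by (smt (verit) Collect_cong divide_nonneg_pos mult_nonneg_nonneg)
  qed
  have E: "mexp (s *\<^sub>R X) *v e = cosh s *\<^sub>R e + sinh s *\<^sub>R w" for s
    by (rule mexp_boost) (simp_all add: mv.scaleR_left Xe)
  have ESO: "mexp (s *\<^sub>R X) \<in> SO_pq" for s by (intro mexp_SO_pq so_pq_scaleR Xso)

  obtain A u s where A: "A \<in> SO_pq" "g = psl_class A" and u: "form u u = 1" "form e u = 0"
    and s: "s \<ge> 0"
    and Ae: "A *v e = cosh s *\<^sub>R e + sinh s *\<^sub>R u \<or> A *v e = - (cosh s *\<^sub>R e + sinh s *\<^sub>R u)"
    using CCG_obtain[OF assms(6)[unfolded pt] e] .
  define v where "v = cosh s *\<^sub>R e + sinh s *\<^sub>R u"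
  have spanv: "span {A *v e} = span {v}"
    using Ae unfolding v_def[symmetric] by (rule disjE) (simp_all only: span_minus_single)
  have abs: "\<bar>form e (A *v e)\<bar> = cosh s"
    using Ae e u by (auto simp: form_simps)
  \<comment> \<open>\<open>h\<close> turns the direction \<open>w\<close> of the chamber into the
    direction \<open>u\<close> in which \<open>g\<close> moves the point.\<close>
  obtain h where h: "h \<in> SO_pq" "h *v e = e" "h *v w = u"
    using SO_pq_transitive[OF d e w u] .
  note hO = SO_pq_O[OF h(1)]

  have "ell pt (psl_act g pt) = s"
    using ell_eq[OF e u s] by (simp add: pt A psl_act_span spanv v_def)

  moreover have "bb pt C g = s *\<^sub>R X"
    unfolding bb_def
  proof (rule the_equality)
    let ?E = "mexp (s *\<^sub>R X)"
    \<comment> \<open>\<open>?K\<close> sends \<open>e\<close> to \<open>v\<close>, and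
      \<open>A\<close> sends it to \<open>v\<close> or \<open>- v\<close>; hence
      \<open>adj ?K ** A\<close> stabilizes the line and supplies the right-hand factor of the
      decomposition.\<close>
    let ?K = "h ** ?E"
    have K: "?K \<in> SO_pq" using h(1) ESO by (rule SO_pq_mult)
    have Ke: "?K *v e = v" by (simp add: E mv_simps h v_def flip: matrix_vector_mul_assoc)
    have "adj ?K *v v = e" using O_pq_inv(3)[OF SO_pq_O[OF K], of e] by (simp only: Ke)
    moreover have "A *v e = v \<or> A *v e = - v" using Ae unfolding v_def .
    ultimately have "adj ?K ** A *v e = e \<or> adj ?K ** A *v e = - e"
      by (metis matrix_vector_mul_assoc mv.minus_right)
    then have "psl_class (adj ?K ** A) \<in> stabilizer pt"
      unfolding pt by (intro stabilizerI SO_pq_mult SO_pq_adj K A)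
    moreover have "psl_class h \<in> stabilizer pt"
      unfolding pt using h by (intro stabilizerI) auto
    moreover have "g = psl_mult (psl_mult (psl_class h) (pexp (s *\<^sub>R X))) (psl_class (adj ?K ** A))"
    proof -
      have "?K ** (adj ?K ** A) = A"
        by (simp add: matrix_mul_assoc O_pq_inv[OF SO_pq_O[OF K]])
      then show ?thesis
        using SO_pq_det[OF SO_pq_mult[OF SO_pq_adj[OF K] A(1)]]
        by (simp add: pexp_def psl_mult_class SO_pq_det h K ESO A)
    qed
    ultimately show "s *\<^sub>R X \<in> C \<and> (\<exists>h\<in>stabilizer pt. \<exists>h'\<in>stabilizer pt.
        g = psl_mult (psl_mult h (pexp (s *\<^sub>R X))) h')"
      using s by (auto simp: C)
  next
    fix Y assume Y: "Y \<in> C \<and> (\<exists>h\<in>stabilizer pt. \<exists>h'\<in>stabilizer pt.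
        g = psl_mult (psl_mult h (pexp Y)) h')"
    then obtain t where t: "t \<ge> 0" "Y = t *\<^sub>R X" by (auto simp: C)
    let ?E = "mexp (t *\<^sub>R X)"
    obtain k k' where k: "k \<in> stabilizer (span {e})" "k' \<in> stabilizer (span {e})"
      "g = psl_mult (psl_mult k (pexp (t *\<^sub>R X))) k'"
      using Y by (auto simp: t pt)
    obtain H where H: "H \<in> SO_pq" "k = psl_class H" "H *v e = e \<or> H *v e = - e"
      using stabilizerD[OF k(1) e] .
    obtain H' where H': "H' \<in> SO_pq" "k' = psl_class H'" "H' *v e = e \<or> H' *v e = - e"
      using stabilizerD[OF k(2) e] .
    have "g = psl_class (H ** ?E ** H')"
      by (simp add: k(3) H H' pexp_def psl_mult_class SO_pq_det SO_pq_mult ESO)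
    \<comment> \<open>Both outer factors fix \<open>e\<close> up to sign, so this invariant of
      \<open>g\<close> equals \<open>cosh t\<close>, and \<open>cosh\<close> is injective on
      nonnegative numbers.\<close>
    then have "\<bar>form e (A *v e)\<bar> = \<bar>form e (H ** ?E ** H' *v e)\<bar>"
      using A by (intro psl_class_eqD SO_pq_mult H H' ESO e) auto
    also have "\<dots> = \<bar>form e (H *v (?E *v e))\<bar>"
      using H'(3) by (auto simp: mv.minus_right form_simps simp flip: matrix_vector_mul_assoc)
    also have "\<dots> = \<bar>form (H *v e) (H *v (?E *v e))\<bar>"
      using H(3) by (auto simp: form_simps)
    also have "\<dots> = cosh t"
      using e w by (simp add: O_pq_form[OF SO_pq_O[OF H(1)]] E form_simps abs_mult)
    finally have "cosh s = cosh t" using abs by simp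
    then show "Y = s *\<^sub>R X" using s t by simp
  qed
  then have "sqrt (nrm (bb pt C g)) = s" using s by (simp add: nrmX)

  moreover have "dXG_set (SS pt) (psl_act g ` SS pt) = ereal s"
  proof (rule antisym)
    have S: "psl_act g ` SS pt = SS (span {v})"
      using psl_act_SS[OF A(1), of e] by (simp add: A(2) pt spanv)
    show "ereal s \<le> dXG_set (SS pt) (psl_act g ` SS pt)"
      unfolding dXG_set_def S v_def unfolding pt
      by (rule Inf_greatest) (use dXG_SS_ge[OF d e u] in blast)
    \<comment> \<open>The transvection towards \<open>u\<close>, based at the translated subspace
      \<open>?\<sigma>\<close>, which still contains \<open>e\<close>. Its exponential carries
      \<open>?\<sigma>\<close> to a subspace containing \<open>v\<close>, at cost
      \<open>s\<close>.\<close>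
    let ?Y = "h ** (s *\<^sub>R X) ** adj h" and ?\<sigma> = "(*v) h ` \<tau>"
    have \<sigma>: "?\<sigma> \<in> XG" by (rule XG_image[OF hO \<tau>(1)])
    have Y: "?Y \<in> pp ?\<sigma>" by (intro pp_image[OF hO \<tau>(1)] pp_scaleR Xpp)
    then have EY: "mexp ?Y \<in> O_pq" by (intro mexp_O_pq) (simp add: pp_def)
    have inv: "adj h *v e = e" "adj h *v u = w"
      using O_pq_inv(3)[OF hO, of e] O_pq_inv(3)[OF hO, of w] h by simp_all
    have "mexp ?Y *v e = v"
      unfolding v_def
      by (rule mexp_boost) (simp_all add: inv Xe mv_simps h flip: matrix_vector_mul_assoc)
    moreover have e\<sigma>: "e \<in> ?\<sigma>" using h(2) \<tau>(2) by (metis imageI)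
    ultimately have "v \<in> (*v) (mexp ?Y) ` ?\<sigma>" by (metis imageI)
    then have "(*v) (mexp ?Y) ` ?\<sigma> \<in> SS (span {v})"
      using XG_image[OF EY \<sigma>] by (simp add: SS_def span_minimal XG_subspace)
    moreover have "?\<sigma> \<in> SS pt"
      using \<sigma> e\<sigma> by (simp add: SS_def pt span_minimal XG_subspace)
    ultimately have "dXG_set (SS pt) (SS (span {v})) \<le> dXG ?\<sigma> ((*v) (mexp ?Y) ` ?\<sigma>)"
      unfolding dXG_set_def by (intro Inf_lower) blast
    also have "\<dots> \<le> ereal (sqrt (nrm ?Y))" by (rule dXG_mexp_le[OF \<sigma> Y])
    also have "\<dots> = ereal s" using s by (simp add: nrm_conj[OF hO] nrmX)
    finally show "dXG_set (SS pt) (psl_act g ` SS pt) \<le> ereal s" by (simp add: S)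
  qed
  ultimately show ?thesis by simp
qed

end
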